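(* Let $n\ge 10$, $\sigma\in[0,1)$, let $A,B\sim W(n,\sigma,\mathrm{id})$, and let $X\in\mathcal{P}_n$ be a fixed (non-random) permutation matrix with $\|X-\mathrm{Id}\|_F\le \theta\sqrt n$, where $0\le\theta\le\sqrt{2(1-\frac{10}{n})}$. Put $c(\sigma)=\frac{1}{384}\left(\frac{1-\sigma^2}{1+2\sigma\sqrt{1-\sigma^2}}\right)$. Then the following holds. (i) For $C=AXB$, $$\mathbb{P}(C\text{ is not diagonally dominant})\le 5n^2e^{-c(\sigma)\left(1-\frac{\theta^2}{2}\right)^2 n}.$$ (ii) Let $\Pi=\tau(AXB)$ be the output of one iteration of PPMGM (the projected power method for graph matching) with input matrices $A,B$ and initial point $X$. Then $$\mathbb{P}(\Pi=\mathrm{Id})\ge 1-5n^2e^{-c(\sigma)\left(1-\frac{\theta^2}{2}\right)^2 n}.$$ In particular, if $\|X-\mathrm{Id}\|_F^2\le 2\Big(n-\sqrt{\tfrac{1}{c(\sigma)}\,n\log(5n^3)}\Big)$, then $\mathbb{P}(\Pi=\mathrm{Id})\ge 1-n^{-1}$.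
   Context: $\mathcal{P}_n$ is the set of $n\times n$ permutation matrices, $\mathrm{Id}$ the identity matrix, $\|\cdot\|_F$ the Frobenius norm. Correlated Gaussian Wigner model $W(n,\sigma,\mathrm{id})$, $\sigma\in[0,1)$: $A$ is a symmetric random $n\times n$ matrix whose entries $(A_{ij})_{i\le j}$ are independent with $A_{ij}\sim\mathcal{N}(0,\frac1n)$ for $i<j$ and $A_{ii}\sim\mathcal{N}(0,\frac2n)$; $Z$ is an independent copy of $A$; and $B_{ij}=\sqrt{1-\sigma^2}\,A_{ij}+\sigma Z_{ij}$ for all $i,j$. A matrix $M\in\mathbb{R}^{n\times n}$ is called diagonally dominant if $M_{ii}>M_{ij}$ for all $i,j$ with $i\ne j$. GMWM (greedy maximum weight matching), denoted $\tau$: given $C\in\mathbb{R}^{n\times n}$, select $(i_1,j_1)$ such that $C_{i_1j_1}$ is the largest entry of $C$ (ties broken arbitrarily), discard row $i_1$ and column $j_1$, select the largest entry $(i_2,j_2)$ among the remaining ones, and so on for $n$ steps; $\tau(C)\in\mathcal{P}_n$ is the permutation matrix with ones exactly at $(i_1,j_1),\dots,(i_n,j_n)$. PPMGM with inputs $A,B$, initial point $X^{(0)}$ and $N$ iterations computes $X^{(k+1)}=\tau(AX^{(k)}B)$ for $k=0,\dots,N-1$ and outputs $X^{(N)}$. *)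

theory Defs
  imports "HOL-Probability.Probability"
begin

definition permutation_matrix :: "real^'n^'n \<Rightarrow> bool" where
  "permutation_matrix P \<longleftrightarrow> (\<exists>p. bij p \<and> P = (\<chi> i j. if j = p i then 1 else 0))"

definition frobenius_norm :: "real^'n^'m \<Rightarrow> real" where
  "frobenius_norm M = sqrt (\<Sum>i\<in>UNIV. \<Sum>j\<in>UNIV. (M $ i $ j)\<^sup>2)"

lemma frobenius_norm_eq_norm: "frobenius_norm M = norm M"
  by (simp add: frobenius_norm_def norm_vec_def L2_set_def sum_nonneg)

(* Only off-diagonal entries in the same row are compared with the diagonal entry,
   and no absolute values are taken. *)
definition diagonally_dominant :: "real^'n^'n \<Rightarrow> bool" where
  "diagonally_dominant M \<longleftrightarrow> (\<forall>i j. i \<noteq> j \<longrightarrow> M $ i $ i > M $ i $ j)"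

(* The second parameter of normal_density is the standard deviation, not the variance. *)
definition gaussian_wigner ::
  "'a measure \<Rightarrow> ('a \<Rightarrow> real^'n::{finite,linorder}^'n::{finite,linorder}) \<Rightarrow> bool" where
  "gaussian_wigner M A \<longleftrightarrow>
     (\<forall>\<omega>\<in>space M. \<forall>i j. A \<omega> $ i $ j = A \<omega> $ j $ i) \<and>
     prob_space.indep_vars M (\<lambda>_. borel) (\<lambda>(i, j) \<omega>. A \<omega> $ i $ j) {(i, j). i \<le> j} \<and>
     (\<forall>i j. i < j \<longrightarrow> distributed M lborel (\<lambda>\<omega>. A \<omega> $ i $ j)
                        (normal_density 0 (sqrt (1 / real CARD('n))))) \<and>
     (\<forall>i. distributed M lborel (\<lambda>\<omega>. A \<omega> $ i $ i)
            (normal_density 0 (sqrt (2 / real CARD('n)))))"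

definition correlated_gaussian_wigner ::
  "'a measure \<Rightarrow> real \<Rightarrow> ('a \<Rightarrow> real^'n::{finite,linorder}^'n::{finite,linorder}) \<Rightarrow>
     ('a \<Rightarrow> real^'n::{finite,linorder}^'n::{finite,linorder}) \<Rightarrow> bool" where
  "correlated_gaussian_wigner M \<sigma> A B \<longleftrightarrow>
     gaussian_wigner M A \<and>
     (\<exists>Z. prob_space.indep_var M borel A borel Z \<and>
          distr M borel Z = distr M borel A \<and>
          (\<forall>\<omega>\<in>space M. \<forall>i j. B \<omega> $ i $ j = sqrt (1 - \<sigma>\<^sup>2) * A \<omega> $ i $ j + \<sigma> * Z \<omega> $ i $ j))"

(* P is a possible result of greedy maximum weight matching on C. The k-th selected entry
   (counting from 0) is (r k, c k). A relation rather than a function, because ties may be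
   broken arbitrarily. *)
definition gmwm :: "real^'n^'n \<Rightarrow> real^'n^'n \<Rightarrow> bool" where
  "gmwm C P \<longleftrightarrow> (\<exists>r c :: nat \<Rightarrow> 'n.
     (\<forall>k<CARD('n).
        r k \<notin> r ` {..<k} \<and> c k \<notin> c ` {..<k} \<and>
        (\<forall>i j. i \<notin> r ` {..<k} \<and> j \<notin> c ` {..<k} \<longrightarrow> C $ i $ j \<le> C $ r k $ c k)) \<and>
     P = (\<chi> i j. if \<exists>k<CARD('n). i = r k \<and> j = c k then 1 else 0))"

(* Y is a possible output of the projected power method for graph matching with input
   matrices A and B, initial point X0 and N iterations. *)
definition ppmgm :: "real^'n^'n \<Rightarrow> real^'n^'n \<Rightarrow> real^'n^'n \<Rightarrow> nat \<Rightarrow> real^'n^'n \<Rightarrow> bool" where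
  "ppmgm A B X0 N Y \<longleftrightarrow> (\<exists>X :: nat \<Rightarrow> real^'n^'n.
     X 0 = X0 \<and> (\<forall>k<N. gmwm (A ** X k ** B) (X (Suc k))) \<and> Y = X N)"

definition c_noise :: "real \<Rightarrow> real" where
  "c_noise \<sigma> = 1 / 384 * ((1 - \<sigma>\<^sup>2) / (1 + 2 * \<sigma> * sqrt (1 - \<sigma>\<^sup>2)))"

end

theory Submission
  imports Defs
begin

text \<open>
  Let \<open>p\<close> be the permutation of \<open>X\<close> and \<open>s = sqrt (1 - \<sigma>\<^sup>2)\<close>, so that \<open>c(\<sigma>) = s\<^sup>2 / (384 (s + \<sigma>)\<^sup>2)\<close>. For
  \<open>i \<noteq> j\<close> the difference \<open>C\<^sub>i\<^sub>i - C\<^sub>i\<^sub>j\<close> is a quadratic form in independent Gaussians, built from about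
  \<open>4n\<close> monomials. Its mean comes from the squares at the fixed points of \<open>p\<close> and is at least
  \<open>s (m - 1) / n\<close>, where \<open>m \<ge> (1 - \<theta>\<^sup>2 / 2) n \<ge> 10\<close> is the number of fixed points. Every coordinate
  occurs in boundedly many monomials; such a form has an exponential moment of sub-Gaussian size,
  as one sees by integrating out one coordinate at a time. A Chernoff bound and a union bound over
  \<open>(i, j)\<close> give (i). The greedy matching of a diagonally dominant matrix only picks diagonal
  entries, which gives (ii).
\<close>

section \<open>Exponential moments of Gaussian quadratic forms\<close>

abbreviation std_gaussian :: "real measure" where
  "std_gaussian \<equiv> density lborel (\<lambda>x. ennreal (std_normal_density x))"

text \<open>Completing the square: with \<open>u = 1 - 2*\<alpha>\<close> the integrand is a
  constant times the density of the normal law with mean \<open>\<beta>/u\<close> and variance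
  \<open>1/u\<close>, which integrates to one.\<close>

lemma std_gaussian_exp_quadratic:
  fixes \<alpha> \<beta> :: real
  assumes "\<alpha> < 1/2"
  shows "(\<integral>\<^sup>+x. ennreal (exp (\<alpha> * x\<^sup>2 + \<beta> * x)) \<partial>std_gaussian)
         = ennreal (1 / sqrt (1 - 2*\<alpha>) * exp (\<beta>\<^sup>2 / (2 * (1 - 2*\<alpha>))))"
proof -
  define u where "u = 1 - 2*\<alpha>"
  have u: "u > 0" and \<alpha>: "\<alpha> = (1 - u)/2" using assms by (auto simp: u_def)
  define C where "C = 1 / sqrt u * exp (\<beta>\<^sup>2 / (2 * u))"
  have C: "C \<ge> 0" using u by (simp add: C_def)
  have *: "std_normal_density x * exp (\<alpha> * x\<^sup>2 + \<beta> * x) = C * normal_density (\<beta>/u) (sqrt (1/u)) x" for x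
  proof -
    have "C * normal_density (\<beta>/u) (sqrt (1/u)) x
        = (1 / sqrt u * (1 / sqrt (2 * pi * (1/u)))) * (exp (\<beta>\<^sup>2 / (2 * u)) * exp (- (x - \<beta>/u)\<^sup>2 / (2 * (1/u))))"
      using u by (simp add: C_def normal_density_def)
    also have "1 / sqrt u * (1 / sqrt (2 * pi * (1/u))) = 1 / sqrt (2 * pi)"
      using u by (simp add: real_sqrt_mult real_sqrt_divide)
    also have "exp (\<beta>\<^sup>2 / (2 * u)) * exp (- (x - \<beta>/u)\<^sup>2 / (2 * (1/u))) = exp (- x\<^sup>2 / 2 + (\<alpha> * x\<^sup>2 + \<beta> * x))"
      unfolding exp_add[symmetric] \<alpha> using u by (simp add: power2_eq_square field_simps)
    also have "1 / sqrt (2 * pi) * \<dots> = std_normal_density x * exp (\<alpha> * x\<^sup>2 + \<beta> * x)"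
      by (simp only: std_normal_density_def exp_add mult.assoc)
    finally show ?thesis by simp
  qed
  have "(\<integral>\<^sup>+x. ennreal (exp (\<alpha> * x\<^sup>2 + \<beta> * x)) \<partial>std_gaussian)
      = (\<integral>\<^sup>+x. ennreal (std_normal_density x * exp (\<alpha> * x\<^sup>2 + \<beta> * x)) \<partial>lborel)"
    by (subst nn_integral_density) (auto simp: ennreal_mult)
  also have "\<dots> = ennreal C * (\<integral>\<^sup>+x. ennreal (normal_density (\<beta>/u) (sqrt (1/u)) x) \<partial>lborel)"
    by (subst nn_integral_cmult[symmetric]) (auto simp: * ennreal_mult C)
  also have "(\<integral>\<^sup>+x. ennreal (normal_density (\<beta>/u) (sqrt (1/u)) x) \<partial>lborel) = 1"
    using u by (subst nn_integral_eq_integral) auto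
  finally show ?thesis by (simp add: C_def u_def)
qed

text \<open>
  Completing the square in the coordinate \<open>k\<close> produces the square of a linear form in the remaining
  coordinates. By Cauchy-Schwarz it is at most a diagonal form, so the off-diagonal coefficients never
  change, and the quantities under the square root are invariant under elimination.
\<close>

lemma gaussian_quadratic_form_exp_bound:
  fixes m :: "'i \<Rightarrow> 'i \<Rightarrow> real"
  assumes "finite I" and \<delta>: "\<delta> < 1/2" and \<kappa>: "\<kappa> = 1 / (2 * (1 - 2*\<delta>))"
    and "\<And>e. e \<in> I \<Longrightarrow> (\<Sum>f\<in>I-{e}. \<bar>m e f + m f e\<bar>) \<le> R"
    and "\<And>e. e \<in> I \<Longrightarrow> m e e + \<kappa> * R * (\<Sum>f\<in>I-{e}. \<bar>m e f + m f e\<bar>) \<le> \<delta>"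
  shows "(\<integral>\<^sup>+x. ennreal (exp (\<Sum>e\<in>I. \<Sum>f\<in>I. m e f * x e * x f)) \<partial>(Pi\<^sub>M I (\<lambda>_. std_gaussian)))
     \<le> ennreal (\<Prod>e\<in>I. 1 / sqrt (1 - 2 * (m e e + \<kappa> * R * (\<Sum>f\<in>I-{e}. \<bar>m e f + m f e\<bar>))))"
  using assms(1,4,5)
proof (induction I arbitrary: m rule: finite_induct)
  case empty
  interpret product_sigma_finite "\<lambda>_. std_gaussian"
    by (simp add: product_sigma_finite_def prob_space_normal_density prob_space_imp_sigma_finite)
  show ?case by (simp add: PiM_empty)
next
  case (insert k I)
  interpret product_sigma_finite "\<lambda>_. std_gaussian"
    by (simp add: product_sigma_finite_def prob_space_normal_density prob_space_imp_sigma_finite)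
  \<comment> \<open>\<open>a f\<close> is the full coefficient of \<open>x k * x f\<close>, since
    \<open>m\<close> need not be symmetric. \<open>D e\<close> is the quantity that elimination of
    \<open>k\<close> preserves, and \<open>m'\<close> is the form that remains: what row
    \<open>e\<close> loses off the diagonal it gains, times \<open>\<kappa> * R\<close>, on the
    diagonal.\<close>
  define a where "a f = m k f + m f k" for f
  define A where "A = (\<Sum>f\<in>I. \<bar>a f\<bar>)"
  define D where "D e = m e e + \<kappa> * R * (\<Sum>f\<in>insert k I-{e}. \<bar>m e f + m f e\<bar>)" for e
  define m' where "m' e f = m e f + (if e = f then \<kappa> * R * \<bar>a e\<bar> else 0)" for e f
  have kI: "insert k I - {k} = I" using insert by auto
  have A: "A \<le> R" using insert.prems(1)[of k] kI by (simp add: A_def a_def)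
  have A0: "0 \<le> A" by (simp add: A_def sum_nonneg)
  have R0: "0 \<le> R" using A A0 by simp
  have \<kappa>0: "0 < \<kappa>" using \<delta> \<kappa> by simp
  have Dk: "m k k \<le> D k" "D k \<le> \<delta>"
    using insert.prems(2)[of k] R0 \<kappa>0 by (auto simp: D_def sum_nonneg)
  have Ie: "insert k I - {e} = insert k (I - {e})" if "e \<in> I" for e using insert that by auto
  have De: "m' e e + \<kappa> * R * (\<Sum>f\<in>I-{e}. \<bar>m' e f + m' f e\<bar>) = D e" if e: "e \<in> I" for e
  proof -
    have "(\<Sum>f\<in>I-{e}. \<bar>m' e f + m' f e\<bar>) = (\<Sum>f\<in>I-{e}. \<bar>m e f + m f e\<bar>)"
      by (intro sum.cong) (auto simp: m'_def)
    then show ?thesis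
      using insert.hyps e by (simp add: D_def Ie[OF e] m'_def a_def algebra_simps)
  qed
  have row: "(\<Sum>f\<in>I-{e}. \<bar>m' e f + m' f e\<bar>) \<le> R" if e: "e \<in> I" for e
  proof -
    have "(\<Sum>f\<in>I-{e}. \<bar>m' e f + m' f e\<bar>) = (\<Sum>f\<in>I-{e}. \<bar>m e f + m f e\<bar>)"
      by (intro sum.cong) (auto simp: m'_def)
    also have "\<dots> \<le> (\<Sum>f\<in>insert k I-{e}. \<bar>m e f + m f e\<bar>)"
      using insert.hyps by (intro sum_mono2) auto
    also have "\<dots> \<le> R" using insert.prems(1)[of e] e by simp
    finally show ?thesis .
  qed
  have IH: "(\<integral>\<^sup>+x. ennreal (exp (\<Sum>e\<in>I. \<Sum>f\<in>I. m' e f * x e * x f)) \<partial>(Pi\<^sub>M I (\<lambda>_. std_gaussian)))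
     \<le> ennreal (\<Prod>e\<in>I. 1 / sqrt (1 - 2 * D e))"
  proof -
    have "(\<Prod>e\<in>I. 1 / sqrt (1 - 2 * D e)) = (\<Prod>e\<in>I. 1 / sqrt (1 - 2 * (m' e e + \<kappa> * R * (\<Sum>f\<in>I-{e}. \<bar>m' e f + m' f e\<bar>))))"
      by (intro prod.cong) (auto simp: De)
    moreover have "m' e e + \<kappa> * R * (\<Sum>f\<in>I-{e}. \<bar>m' e f + m' f e\<bar>) \<le> \<delta>" if "e \<in> I" for e
      unfolding De[OF that] using insert.prems(2)[of e] that by (simp add: D_def)
    ultimately show ?thesis using insert.IH[of m'] row by simp
  qed
  have inner: "(\<integral>\<^sup>+y. ennreal (exp (\<Sum>e\<in>insert k I. \<Sum>f\<in>insert k I. m e f * (x(k:=y)) e * (x(k:=y)) f)) \<partial>std_gaussian)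
      \<le> ennreal (1 / sqrt (1 - 2 * D k)) * ennreal (exp (\<Sum>e\<in>I. \<Sum>f\<in>I. m' e f * x e * x f))" for x
  proof -
    define Q where "Q = (\<Sum>e\<in>I. \<Sum>f\<in>I. m e f * x e * x f)"
    define L where "L = (\<Sum>f\<in>I. a f * x f)"
    have eq: "(\<Sum>e\<in>insert k I. \<Sum>f\<in>insert k I. m e f * (x(k:=y)) e * (x(k:=y)) f)
        = Q + (m k k * y\<^sup>2 + L * y)" for y
    proof -
      define z where "z = x(k:=y)"
      have z: "z k = y" "\<And>e. e \<in> I \<Longrightarrow> z e = x e" using insert.hyps by (auto simp: z_def)
      have "(\<Sum>e\<in>insert k I. \<Sum>f\<in>insert k I. m e f * z e * z f)
          = m k k * y * y + (\<Sum>f\<in>I. m k f * y * x f) + ((\<Sum>e\<in>I. m e k * x e * y) + Q)"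
        using insert.hyps by (simp add: z Q_def sum.distrib cong: sum.cong)
      then show ?thesis unfolding z_def
        by (simp add: L_def a_def sum_distrib_left sum_distrib_right sum.distrib algebra_simps power2_eq_square)
    qed
    have "(\<integral>\<^sup>+y. ennreal (exp (\<Sum>e\<in>insert k I. \<Sum>f\<in>insert k I. m e f * (x(k:=y)) e * (x(k:=y)) f)) \<partial>std_gaussian)
       = ennreal (exp Q) * (\<integral>\<^sup>+y. ennreal (exp (m k k * y\<^sup>2 + L * y)) \<partial>std_gaussian)"
      unfolding eq exp_add[of Q] by (subst nn_integral_cmult[symmetric]) (auto simp: ennreal_mult)
    also have "\<dots> = ennreal (exp Q * (1 / sqrt (1 - 2 * m k k) * exp (L\<^sup>2 / (2 * (1 - 2 * m k k)))))"
      using Dk \<delta> by (subst std_gaussian_exp_quadratic) (auto simp: ennreal_mult'[symmetric])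
    \<comment> \<open>From \<open>m k k \<le> D k \<le> \<delta>\<close> the factor
      \<open>1 / (2 * (1 - 2 * m k k))\<close> is at most \<open>\<kappa>\<close>; the same
      \<open>\<kappa>\<close> thus serves for every coordinate that is eliminated.\<close>
    also have "\<dots> \<le> ennreal (exp Q * (1 / sqrt (1 - 2 * D k) * exp (\<kappa> * R * (\<Sum>f\<in>I. \<bar>a f\<bar> * (x f)\<^sup>2))))"
    proof (intro ennreal_leI mult_left_mono mult_mono)
      show "1 / sqrt (1 - 2 * m k k) \<le> 1 / sqrt (1 - 2 * D k)"
        using Dk \<delta> by (intro divide_left_mono) (auto simp: mult_pos_pos)
      \<comment> \<open>The weight of each term is split evenly between the two factors of
        Cauchy-Schwarz: the first sum becomes \<open>A\<close>, hence at most \<open>R\<close>, and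
        the second is a diagonal form.\<close>
      have "L\<^sup>2 = (\<Sum>f\<in>I. (sgn (a f) * sqrt \<bar>a f\<bar>) * (sqrt \<bar>a f\<bar> * x f))\<^sup>2"
        unfolding L_def by (intro arg_cong[of _ _ "\<lambda>x. x\<^sup>2"] sum.cong refl)
          (auto simp: sgn_if)
      also have "\<dots> \<le> (\<Sum>f\<in>I. (sgn (a f) * sqrt \<bar>a f\<bar>)\<^sup>2) * (\<Sum>f\<in>I. (sqrt \<bar>a f\<bar> * x f)\<^sup>2)"
        by (rule Cauchy_Schwarz_ineq_sum)
      also have "\<dots> = A * (\<Sum>f\<in>I. \<bar>a f\<bar> * (x f)\<^sup>2)"
        unfolding A_def by (intro arg_cong2[of _ _ _ _ "(*)"] sum.cong refl)
          (auto simp: power_mult_distrib sgn_if)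
      also have "\<dots> \<le> R * (\<Sum>f\<in>I. \<bar>a f\<bar> * (x f)\<^sup>2)"
        using A by (intro mult_right_mono sum_nonneg) auto
      finally have L2: "L\<^sup>2 \<le> R * (\<Sum>f\<in>I. \<bar>a f\<bar> * (x f)\<^sup>2)" .
      have "L\<^sup>2 / (2 * (1 - 2 * m k k)) = L\<^sup>2 * (1 / (2 * (1 - 2 * m k k)))" by simp
      also have "\<dots> \<le> L\<^sup>2 * \<kappa>"
        unfolding \<kappa> using Dk \<delta> by (intro mult_left_mono divide_left_mono) (auto simp: mult_pos_pos)
      also have "\<dots> \<le> (R * (\<Sum>f\<in>I. \<bar>a f\<bar> * (x f)\<^sup>2)) * \<kappa>"
        using L2 \<kappa>0 by (intro mult_right_mono) auto
      finally show "exp (L\<^sup>2 / (2 * (1 - 2 * m k k))) \<le> exp (\<kappa> * R * (\<Sum>f\<in>I. \<bar>a f\<bar> * (x f)\<^sup>2))"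
        by (simp add: mult_ac)
    qed (use Dk \<delta> in auto)
    also have "exp Q * (1 / sqrt (1 - 2 * D k) * exp (\<kappa> * R * (\<Sum>f\<in>I. \<bar>a f\<bar> * (x f)\<^sup>2)))
        = 1 / sqrt (1 - 2 * D k) * exp (Q + \<kappa> * R * (\<Sum>f\<in>I. \<bar>a f\<bar> * (x f)\<^sup>2))"
      by (simp add: exp_add)
    also have "Q + \<kappa> * R * (\<Sum>f\<in>I. \<bar>a f\<bar> * (x f)\<^sup>2) = (\<Sum>e\<in>I. \<Sum>f\<in>I. m' e f * x e * x f)"
    proof -
      have "(\<Sum>f\<in>I. m' e f * x e * x f) = (\<Sum>f\<in>I. m e f * x e * x f) + \<kappa> * R * (\<bar>a e\<bar> * (x e)\<^sup>2)" if "e \<in> I" for e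
      proof -
        have "(\<Sum>f\<in>I. m' e f * x e * x f) = (\<Sum>f\<in>I. m e f * x e * x f + (if e = f then \<kappa> * R * \<bar>a e\<bar> * x e * x f else 0))"
          by (intro sum.cong refl) (auto simp: m'_def algebra_simps)
        also have "\<dots> = (\<Sum>f\<in>I. m e f * x e * x f) + \<kappa> * R * \<bar>a e\<bar> * x e * x e"
          using insert.hyps that by (simp add: sum.distrib sum.delta)
        finally show ?thesis by (simp add: power2_eq_square algebra_simps)
      qed
      then show ?thesis by (simp add: Q_def sum.distrib sum_distrib_left)
    qed
    finally show ?thesis
      using Dk \<delta> by (subst ennreal_mult'[symmetric]) auto
  qed
  have meas: "(\<lambda>x. ennreal (exp (\<Sum>e\<in>I. \<Sum>f\<in>I. m e f * x e * x f))) \<in> borel_measurable (Pi\<^sub>M I (\<lambda>_. std_gaussian))"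
    if "finite I" for I :: "'i set" and m
  proof -
    have c: "(\<lambda>x. x e) \<in> borel_measurable (Pi\<^sub>M I (\<lambda>_. std_gaussian))" if "e \<in> I" for e
      using measurable_component_singleton[OF that, of "\<lambda>_. std_gaussian"] by simp
    show ?thesis by (intro measurable_compose[OF _ measurable_ennreal] borel_measurable_exp borel_measurable_sum borel_measurable_times borel_measurable_const c
       measurable_compose[OF _ borel_measurable_exp])
  qed
  have "(\<integral>\<^sup>+x. ennreal (exp (\<Sum>e\<in>insert k I. \<Sum>f\<in>insert k I. m e f * x e * x f)) \<partial>(Pi\<^sub>M (insert k I) (\<lambda>_. std_gaussian)))
     = (\<integral>\<^sup>+x. (\<integral>\<^sup>+y. ennreal (exp (\<Sum>e\<in>insert k I. \<Sum>f\<in>insert k I. m e f * (x(k:=y)) e * (x(k:=y)) f)) \<partial>std_gaussian) \<partial>(Pi\<^sub>M I (\<lambda>_. std_gaussian)))"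
    using insert.hyps by (intro product_nn_integral_insert meas) auto
  also have "\<dots> \<le> (\<integral>\<^sup>+x. ennreal (1 / sqrt (1 - 2 * D k)) * ennreal (exp (\<Sum>e\<in>I. \<Sum>f\<in>I. m' e f * x e * x f)) \<partial>(Pi\<^sub>M I (\<lambda>_. std_gaussian)))"
    by (intro nn_integral_mono inner)
  also have "\<dots> = ennreal (1 / sqrt (1 - 2 * D k)) * (\<integral>\<^sup>+x. ennreal (exp (\<Sum>e\<in>I. \<Sum>f\<in>I. m' e f * x e * x f)) \<partial>(Pi\<^sub>M I (\<lambda>_. std_gaussian)))"
    using insert.hyps by (intro nn_integral_cmult meas)
  also have "\<dots> \<le> ennreal (1 / sqrt (1 - 2 * D k)) * ennreal (\<Prod>e\<in>I. 1 / sqrt (1 - 2 * D e))"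
    by (intro mult_left_mono IH) auto
  also have "\<dots> = ennreal (\<Prod>e\<in>insert k I. 1 / sqrt (1 - 2 * D e))"
    using insert.hyps Dk \<delta> by (subst ennreal_mult'[symmetric]) auto
  finally show ?case by (simp only: D_def)
qed

text \<open>Apply \<open>1 + y \<le> exp y\<close> to
  \<open>1 / (1 - 2*D) = 1 + 2*D / (1 - 2*D)\<close> and take the root. The exponent
  \<open>D / (1 - 2*D)\<close> exceeds \<open>D\<close> by \<open>2 * D\<^sup>2 / (1 - 2*D)\<close>,
  where \<open>1 - 2*D \<ge> 9/10\<close>. Negative \<open>D\<close> is allowed, so the linear gain
  from negative squares survives.\<close>

lemma inverse_sqrt_le_exp:
  fixes D :: real
  assumes "D \<le> 1/20"
  shows "1 / sqrt (1 - 2*D) \<le> exp (D + 20/9 * D\<^sup>2)"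
proof -
  have pos: "0 < 1 - 2*D" using assms by simp
  have "1 / (1 - 2*D) = 1 + 2*D / (1 - 2*D)" using pos by (simp add: field_simps)
  also have "\<dots> \<le> exp (2*D / (1 - 2*D))" by (rule exp_ge_add_one_self)
  finally have "sqrt (1 / (1 - 2*D)) \<le> sqrt (exp (2*D / (1 - 2*D)))" by simp
  also have "\<dots> = exp (D / (1 - 2*D))"
    using exp_double[of "D / (1 - 2*D)"] by simp
  also have "D / (1 - 2*D) = D + 2 * D\<^sup>2 / (1 - 2*D)"
    using pos by (simp add: field_simps power2_eq_square)
  also have "2 * D\<^sup>2 / (1 - 2*D) \<le> 2 * D\<^sup>2 / (9/10)"
    using assms by (intro divide_left_mono) (auto intro!: mult_pos_pos)
  finally show ?thesis by (simp add: real_sqrt_divide)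
qed

text \<open>The form is given as a list of monomials that may repeat a pair of coordinates, so
  coincidences need not be resolved by the caller. \<open>R\<close> bounds the weighted number of
  occurrences of a coordinate, squares counting twice. The elimination bound is used with
  \<open>\<delta> = 1/20\<close>; its factors are turned into exponentials, and the exponents add up
  to the coefficients of the squares plus an error of \<open>3 * R\<close> times the total
  weight.\<close>

lemma gaussian_monomials_exp_bound:
  fixes c :: "'l \<Rightarrow> real" and e f :: "'l \<Rightarrow> 'i"
  assumes I: "finite I" and L: "finite L" and e: "e ` L \<subseteq> I" and f: "f ` L \<subseteq> I"
    and \<rho>: "\<And>u. u \<in> I \<Longrightarrow> (\<Sum>l\<in>L. \<bar>c l\<bar> * (of_bool (e l = u) + of_bool (f l = u))) \<le> R"
    and R: "0 \<le> R" "R \<le> 1/20"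
  shows "(\<integral>\<^sup>+x. ennreal (exp (\<Sum>l\<in>L. c l * x (e l) * x (f l))) \<partial>(Pi\<^sub>M I (\<lambda>_. std_gaussian)))
     \<le> ennreal (exp ((\<Sum>l\<in>{l\<in>L. e l = f l}. c l) + 3 * R * (\<Sum>l\<in>L. \<bar>c l\<bar>)))"
proof -
  define \<rho>' where "\<rho>' u = (\<Sum>l\<in>L. \<bar>c l\<bar> * (of_bool (e l = u) + of_bool (f l = u)))" for u
  define m where "m u v = (\<Sum>l\<in>L. c l * of_bool (e l = u \<and> f l = v))" for u v
  define T where "T u = (\<Sum>v\<in>I-{u}. \<bar>m u v + m v u\<bar>)" for u
  \<comment> \<open>\<open>5/9\<close> is the value of \<open>\<kappa>\<close> at
    \<open>\<delta> = 1/20\<close>.\<close>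
  define D where "D u = m u u + 5/9 * R * T u" for u
  have ef: "e l \<in> I" "f l \<in> I" if "l \<in> L" for l using that e f by auto
  have form: "(\<Sum>u\<in>I. \<Sum>v\<in>I. m u v * x u * x v) = (\<Sum>l\<in>L. c l * x (e l) * x (f l))" for x :: "'i \<Rightarrow> real"
  proof -
    have "(\<Sum>u\<in>I. \<Sum>v\<in>I. m u v * x u * x v)
        = (\<Sum>u\<in>I. \<Sum>v\<in>I. \<Sum>l\<in>L. c l * of_bool (e l = u \<and> f l = v) * x u * x v)"
      by (simp add: m_def sum_distrib_right)
    also have "\<dots> = (\<Sum>u\<in>I. \<Sum>l\<in>L. \<Sum>v\<in>I. c l * of_bool (e l = u \<and> f l = v) * x u * x v)"
      by (intro sum.cong refl sum.swap)
    also have "\<dots> = (\<Sum>l\<in>L. \<Sum>u\<in>I. \<Sum>v\<in>I. c l * of_bool (e l = u \<and> f l = v) * x u * x v)"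
      by (rule sum.swap)
    also have "\<dots> = (\<Sum>l\<in>L. \<Sum>u\<in>I. if u = e l then (\<Sum>v\<in>I. if v = f l then c l * x (e l) * x (f l) else 0) else 0)"
      by (intro sum.cong refl) (auto intro!: sum.cong sum.neutral)
    also have "\<dots> = (\<Sum>l\<in>L. c l * x (e l) * x (f l))"
      using I ef by (intro sum.cong refl) (simp add: sum.delta)
    finally show ?thesis .
  qed
  have T: "T u \<le> \<rho>' u" if u: "u \<in> I" for u
  proof -
    have "T u \<le> (\<Sum>v\<in>I-{u}. \<Sum>l\<in>L. \<bar>c l\<bar> * (of_bool (e l = u \<and> f l = v) + of_bool (e l = v \<and> f l = u)))"
      unfolding T_def m_def sum.distrib[symmetric]
      by (intro sum_mono order_trans[OF sum_abs] sum_mono) auto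
    also have "\<dots> = (\<Sum>l\<in>L. \<Sum>v\<in>I-{u}. \<bar>c l\<bar> * (of_bool (e l = u \<and> f l = v) + of_bool (e l = v \<and> f l = u)))"
      by (rule sum.swap)
    also have "\<dots> \<le> (\<Sum>l\<in>L. \<Sum>v\<in>I. \<bar>c l\<bar> * (of_bool (e l = u \<and> f l = v) + of_bool (e l = v \<and> f l = u)))"
      using I by (intro sum_mono sum_mono2) auto
    also have "\<dots> = (\<Sum>l\<in>L. \<Sum>v\<in>I. (if v = f l then \<bar>c l\<bar> * of_bool (e l = u) else 0)
          + (if v = e l then \<bar>c l\<bar> * of_bool (f l = u) else 0))"
      by (intro sum.cong refl) auto
    also have "\<dots> = \<rho>' u"
      unfolding \<rho>'_def using I ef by (intro sum.cong refl) (simp add: sum.distrib sum.delta algebra_simps)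
    finally show ?thesis .
  qed
  have T0: "0 \<le> T u" for u by (simp add: T_def sum_nonneg)
  have \<rho>R: "\<rho>' u \<le> R" if "u \<in> I" for u using \<rho>[OF that] by (simp add: \<rho>'_def)
  \<comment> \<open>A square in \<open>u\<close> contributes its coefficient twice to
    \<open>\<rho>' u\<close>.\<close>
  have md: "\<bar>m u u\<bar> \<le> \<rho>' u / 2" for u
    unfolding m_def \<rho>'_def sum_divide_distrib
    by (intro order_trans[OF sum_abs] sum_mono) auto
  \<comment> \<open>The constant is \<open>1/2 + 5/9 * 1/20\<close>.\<close>
  have DD: "\<bar>D u\<bar> \<le> 19/36 * \<rho>' u" if u: "u \<in> I" for u
  proof -
    have "R * T u \<le> 1/20 * \<rho>' u" using R T[OF u] T0[of u] by (intro mult_mono) auto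
    moreover have "0 \<le> R * T u" using R T0 by simp
    moreover have "D u = m u u + 5/9 * (R * T u)" by (simp add: D_def)
    ultimately show ?thesis using md[of u] by linarith
  qed
  have D20: "D u \<le> 1/20" if "u \<in> I" for u
    using DD[OF that] \<rho>R[OF that] R by linarith
  \<comment> \<open>The quadratic error is at most \<open>20/9 * 361/1296 < 7/10\<close> and the
    off-diagonal part of \<open>D u\<close> at most \<open>5/9\<close>, both in units of
    \<open>R * \<rho>' u\<close>; together they stay below \<open>3/2\<close>.\<close>
  have factor: "1 / sqrt (1 - 2 * D u) \<le> exp (m u u + 3/2 * R * \<rho>' u)" if u: "u \<in> I" for u
  proof -
    have "\<rho>' u \<ge> 0" using T[OF u] T0[of u] by linarith
    have "(D u)\<^sup>2 \<le> (19/36 * \<rho>' u)\<^sup>2"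
      using DD[OF u] by (metis abs_ge_zero power2_abs power_mono)
    also have "\<dots> = 361/1296 * (\<rho>' u * \<rho>' u)" by (simp add: power2_eq_square)
    also have "\<dots> \<le> 361/1296 * (R * \<rho>' u)"
      using \<open>\<rho>' u \<ge> 0\<close> \<rho>R[OF u] by (intro mult_left_mono mult_right_mono) auto
    finally have "20/9 * (D u)\<^sup>2 \<le> 7/10 * (R * \<rho>' u)"
      using mult_nonneg_nonneg[OF R(1) \<open>\<rho>' u \<ge> 0\<close>] by linarith
    moreover have "R * T u \<le> R * \<rho>' u" using R T[OF u] by (intro mult_left_mono)
    ultimately have "D u + 20/9 * (D u)\<^sup>2 \<le> m u u + 3/2 * R * \<rho>' u"
      using mult_nonneg_nonneg[OF R(1) \<open>\<rho>' u \<ge> 0\<close>] unfolding D_def by linarith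
    then show ?thesis
      using order_trans[OF inverse_sqrt_le_exp[OF D20[OF u]]] by simp
  qed
  have "(\<integral>\<^sup>+x. ennreal (exp (\<Sum>l\<in>L. c l * x (e l) * x (f l))) \<partial>(Pi\<^sub>M I (\<lambda>_. std_gaussian)))
      \<le> ennreal (\<Prod>u\<in>I. 1 / sqrt (1 - 2 * D u))"
    unfolding form[symmetric] D_def T_def
    using T \<rho>R D20
    by (intro gaussian_quadratic_form_exp_bound[OF I, where \<delta> = "1/20"])
      (auto simp: T_def D_def intro: order_trans)
  also have "\<dots> \<le> ennreal (\<Prod>u\<in>I. exp (m u u + 3/2 * R * \<rho>' u))"
  proof (intro ennreal_leI prod_mono conjI)
    show "0 \<le> 1 / sqrt (1 - 2 * D u)" if "u \<in> I" for u using D20[OF that] by simp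
  qed (rule factor)
  also have "(\<Prod>u\<in>I. exp (m u u + 3/2 * R * \<rho>' u)) = exp ((\<Sum>u\<in>I. m u u) + 3/2 * R * (\<Sum>u\<in>I. \<rho>' u))"
    using I by (simp add: exp_sum[symmetric] sum.distrib sum_distrib_left)
  also have "(\<Sum>u\<in>I. m u u) = (\<Sum>l\<in>{l\<in>L. e l = f l}. c l)"
  proof -
    have "(\<Sum>u\<in>I. m u u) = (\<Sum>l\<in>L. \<Sum>u\<in>I. c l * of_bool (e l = u \<and> f l = u))"
      unfolding m_def by (rule sum.swap)
    also have "\<dots> = (\<Sum>l\<in>L. \<Sum>u\<in>I. if u = e l then (if e l = f l then c l else 0) else 0)"
      by (intro sum.cong refl) auto
    also have "\<dots> = (\<Sum>l\<in>L. if e l = f l then c l else 0)"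
      using I ef by (intro sum.cong refl) (simp add: sum.delta)
    also have "\<dots> = (\<Sum>l\<in>{l\<in>L. e l = f l}. c l)"
      using L by (simp add: sum.inter_filter)
    finally show ?thesis .
  qed
  \<comment> \<open>Each monomial is counted once for each of its two factors, which turns
    \<open>3/2\<close> into \<open>3\<close>.\<close>
  also have "(\<Sum>u\<in>I. \<rho>' u) = 2 * (\<Sum>l\<in>L. \<bar>c l\<bar>)"
  proof -
    have "(\<Sum>u\<in>I. \<rho>' u) = (\<Sum>l\<in>L. \<Sum>u\<in>I. \<bar>c l\<bar> * (of_bool (e l = u) + of_bool (f l = u)))"
      unfolding \<rho>'_def by (rule sum.swap)
    also have "\<dots> = (\<Sum>l\<in>L. \<Sum>u\<in>I. (if u = e l then \<bar>c l\<bar> else 0) + (if u = f l then \<bar>c l\<bar> else 0))"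
      by (intro sum.cong refl) auto
    also have "\<dots> = (\<Sum>l\<in>L. 2 * \<bar>c l\<bar>)"
      using I ef by (intro sum.cong refl) (simp add: sum.distrib sum.delta)
    finally show ?thesis by (simp add: sum_distrib_left)
  qed
  finally show ?thesis by (simp add: mult.assoc)
qed

section \<open>Gaussian Wigner matrices as functions of independent coordinates\<close>

text \<open>The standard deviation of a Wigner entry in units of \<open>1 / sqrt n\<close>.\<close>

definition entry_scale :: "'n \<Rightarrow> 'n \<Rightarrow> real" where
  "entry_scale u v = (if u = v then sqrt 2 else 1)"

text \<open>
  The tag distinguishes the coordinates of \<open>A\<close> (\<open>True\<close>) from those of the noise \<open>Z\<close> (\<open>False\<close>);
  \<open>min\<close> and \<open>max\<close> make the coordinate depend on the unordered pair only.
\<close>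

definition wigner_key :: "bool \<Rightarrow> 'n::linorder \<Rightarrow> 'n \<Rightarrow> bool \<times> 'n \<times> 'n" where
  "wigner_key c u v = (c, min u v, max u v)"

text \<open>The family \<open>x\<close> may carry the coordinates of both matrices; \<open>c\<close>
  selects the block that is read. Independent standard normal coordinates yield a Gaussian Wigner
  matrix.\<close>

definition wigner_of :: "bool \<Rightarrow> (bool \<times> 'n \<times> 'n \<Rightarrow> real) \<Rightarrow> real^'n::{finite,linorder}^'n::{finite,linorder}" where
  "wigner_of c x = (\<chi> u v. entry_scale u v / sqrt (real CARD('n)) * x (wigner_key c u v))"

lemma min_le_max: "min u v \<le> max u (v :: 'n :: linorder)"
  by (cases "u \<le> v") auto

lemma wigner_key_mem: "wigner_key c u v \<in> {c} \<times> {(u, v). u \<le> v}"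
  by (simp add: wigner_key_def min_le_max)

lemma borel_measurable_matrix:
  fixes F :: "'a \<Rightarrow> real^'n^'m"
  assumes "\<And>i j. (\<lambda>x. F x $ i $ j) \<in> borel_measurable M"
  shows "F \<in> borel_measurable M"
proof (subst borel_measurable_euclidean_space, intro ballI)
  fix b :: "real^'n^'m" assume "b \<in> Basis"
  then obtain i j where "b = axis i (axis j 1)"
    by (auto simp: Basis_vec_def)
  then show "(\<lambda>x. F x \<bullet> b) \<in> borel_measurable M"
    using assms[of i j] by (simp add: inner_axis)
qed

lemma measurable_wigner_of:
  assumes "{c} \<times> {(u, v). u \<le> v} \<subseteq> K"
  shows "wigner_of c \<in> borel_measurable (Pi\<^sub>M K (\<lambda>_. std_gaussian))"
proof (rule borel_measurable_matrix)
  fix i j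
  have "wigner_key c i j \<in> K" using assms wigner_key_mem by blast
  from measurable_component_singleton[OF this, of "\<lambda>_. std_gaussian"]
  have "(\<lambda>x. x (wigner_key c i j)) \<in> borel_measurable (Pi\<^sub>M K (\<lambda>_. std_gaussian))" by simp
  then show "(\<lambda>x. wigner_of c x $ i $ j) \<in> borel_measurable (Pi\<^sub>M K (\<lambda>_. std_gaussian))"
    by (simp add: wigner_of_def)
qed

text \<open>The normalised entries on and above the diagonal are independent and standard normal, so
  their joint law is a product measure, and by symmetry they determine the whole matrix. The law of
  \<open>A\<close> can thus be computed on an explicit product space.\<close>

lemma distr_gaussian_wigner:
  fixes A :: "'a \<Rightarrow> real^'n::{finite,linorder}^'n::{finite,linorder}"
  assumes "prob_space M" and "gaussian_wigner M A"
  shows "distr M borel A = distr (Pi\<^sub>M ({c} \<times> {(u, v). u \<le> v}) (\<lambda>_. std_gaussian)) borel (wigner_of c)"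
proof -
  interpret prob_space M by fact
  define K :: "(bool \<times> 'n \<times> 'n) set" where "K = {c} \<times> {(u, v). u \<le> v}"
  define g :: "bool \<times> 'n \<times> 'n \<Rightarrow> 'a \<Rightarrow> real" where
    "g = (\<lambda>(_, u, v) \<omega>. sqrt (real CARD('n)) / entry_scale u v * A \<omega> $ u $ v)"
  have sc: "entry_scale u v > 0" for u v :: 'n by (simp add: entry_scale_def)
  have n: "real CARD('n) > 0" by simp
  have sym: "A \<omega> $ u $ v = A \<omega> $ v $ u" if "\<omega> \<in> space M" for \<omega> u v
    using assms(2) that by (simp add: gaussian_wigner_def)
  have ind: "indep_vars (\<lambda>_. borel) (\<lambda>(i, j) \<omega>. A \<omega> $ i $ j) {(i, j). i \<le> j}"
    using assms(2) by (simp add: gaussian_wigner_def)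
  have dist: "distributed M lborel (\<lambda>\<omega>. A \<omega> $ u $ v)
      (normal_density 0 (entry_scale u v / sqrt (real CARD('n))))" if "u \<le> v" for u v
    using assms(2) that by (auto simp: gaussian_wigner_def entry_scale_def real_sqrt_divide)
  \<comment> \<open>Independence is given over the untagged pairs \<open>J\<close>, while the
    product space is indexed by the tagged copy \<open>K\<close>; the law is first found over
    \<open>J\<close> and then reindexed along \<open>snd\<close>.\<close>
  define J :: "('n \<times> 'n) set" where "J = {(u, v). u \<le> v}"
  define g0 :: "'n \<times> 'n \<Rightarrow> 'a \<Rightarrow> real" where
    "g0 = (\<lambda>(u, v) \<omega>. sqrt (real CARD('n)) / entry_scale u v * A \<omega> $ u $ v)"
  have g: "g k = g0 (snd k)" for k by (cases k) (auto simp: g_def g0_def)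
  have K: "inj_on snd K" "snd \<in> K \<rightarrow> J" by (auto simp: K_def J_def inj_on_def)
  have g_distr: "distributed M lborel (g0 k) std_normal_density" if "k \<in> J" for k
  proof -
    obtain u v where k: "k = (u, v)" and uv: "u \<le> v" using \<open>k \<in> J\<close> by (auto simp: J_def)
    show ?thesis
      using normal_density_affine[OF dist[OF uv], of "sqrt (real CARD('n)) / entry_scale u v" 0]
        sc[of u v] n by (simp add: k g0_def)
  qed
  have g_law: "distr M borel (g0 k) = std_gaussian" if "k \<in> J" for k
  proof -
    have "distr M borel (g0 k) = distr M lborel (g0 k)" by (intro distr_cong) auto
    then show ?thesis using distributed_distr_eq_density[OF g_distr[OF that]] by simp
  qed
  have g_meas: "g0 k \<in> borel_measurable M" if "k \<in> J" for k
    using distributed_measurable[OF g_distr[OF that]] by simp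
  have "indep_vars (\<lambda>_. borel) (\<lambda>k \<omega>. sqrt (real CARD('n)) / entry_scale (fst k) (snd k)
      * (\<lambda>(i, j) \<omega>. A \<omega> $ i $ j) k \<omega>) J"
    using ind unfolding J_def by (rule indep_vars_compose2) simp
  then have "indep_vars (\<lambda>_. borel) g0 J"
    by (simp add: g0_def case_prod_unfold)
  moreover have "J \<noteq> {}" by (auto simp: J_def)
  ultimately have "distr M (Pi\<^sub>M J (\<lambda>_. borel)) (\<lambda>\<omega>. \<lambda>k\<in>J. g0 k \<omega>) = Pi\<^sub>M J (\<lambda>k. distr M borel (g0 k))"
    using g_meas by (subst indep_vars_iff_distr_eq_PiM'[symmetric]) auto
  also have "\<dots> = Pi\<^sub>M J (\<lambda>_. std_gaussian)"
    by (intro PiM_cong refl g_law)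
  finally have law0: "distr M (Pi\<^sub>M J (\<lambda>_. borel)) (\<lambda>\<omega>. \<lambda>k\<in>J. g0 k \<omega>) = Pi\<^sub>M J (\<lambda>_. std_gaussian)" .
  have "Pi\<^sub>M K (\<lambda>_. std_gaussian)
      = distr (Pi\<^sub>M J (\<lambda>_. std_gaussian)) (Pi\<^sub>M K (\<lambda>_. std_gaussian)) (\<lambda>x. \<lambda>k\<in>K. x (snd k))"
    using K by (intro distr_PiM_reindex[symmetric] prob_space_normal_density) auto
  also have "\<dots> = distr (Pi\<^sub>M J (\<lambda>_. std_gaussian)) (Pi\<^sub>M K (\<lambda>_. borel)) (\<lambda>x. \<lambda>k\<in>K. x (snd k))"
    by (intro distr_cong sets_PiM_cong) auto
  also have "\<dots> = distr M (Pi\<^sub>M K (\<lambda>_. borel)) ((\<lambda>x. \<lambda>k\<in>K. x (snd k)) \<circ> (\<lambda>\<omega>. \<lambda>k\<in>J. g0 k \<omega>))"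
    unfolding law0[symmetric] using K g_meas
    by (intro distr_distr measurable_restrict measurable_component_singleton) auto
  also have "(\<lambda>x. \<lambda>k\<in>K. x (snd k)) \<circ> (\<lambda>\<omega>. \<lambda>k\<in>J. g0 k \<omega>) = (\<lambda>\<omega>. \<lambda>k\<in>K. g k \<omega>)"
    by (auto simp: fun_eq_iff g K_def J_def)
  finally have law: "distr M (Pi\<^sub>M K (\<lambda>_. borel)) (\<lambda>\<omega>. \<lambda>k\<in>K. g k \<omega>) = Pi\<^sub>M K (\<lambda>_. std_gaussian)" ..
  have sets_eq: "sets (Pi\<^sub>M K (\<lambda>_. std_gaussian)) = sets (Pi\<^sub>M K (\<lambda>_. borel :: real measure))"
    by (intro sets_PiM_cong) auto
  have wm: "wigner_of c \<in> borel_measurable (Pi\<^sub>M K (\<lambda>_. borel))"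
    using measurable_wigner_of[of c K] measurable_cong_sets[OF sets_eq refl] by (simp add: K_def)
  have Aeq: "A \<omega> = wigner_of c (\<lambda>k\<in>K. g k \<omega>)" if "\<omega> \<in> space M" for \<omega>
  proof -
    have "wigner_of c (\<lambda>k\<in>K. g k \<omega>) $ u $ v = A \<omega> $ u $ v" for u v
      using wigner_key_mem[of c u v] sc[of u v] n sym[OF that, of u v]
      by (cases "u \<le> v") (auto simp: wigner_of_def g_def K_def wigner_key_def entry_scale_def min_def max_def)
    then show ?thesis by (simp add: vec_eq_iff)
  qed
  have "distr M borel A = distr M borel (\<lambda>\<omega>. wigner_of c (\<lambda>k\<in>K. g k \<omega>))"
    by (intro distr_cong refl Aeq)
  also have "\<dots> = distr (distr M (Pi\<^sub>M K (\<lambda>_. borel)) (\<lambda>\<omega>. \<lambda>k\<in>K. g k \<omega>)) borel (wigner_of c)"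
    using g_meas wm by (subst distr_distr) (auto simp: comp_def g K_def J_def intro!: measurable_restrict)
  finally show ?thesis unfolding law unfolding K_def .
qed

text \<open>By independence the pair has a product law, and each factor is the image of one block of
  coordinates. Fubini merges the two blocks into a single Gaussian product, the setting of the
  exponential moment bound.\<close>

lemma nn_integral_indep_wigner:
  fixes A Z :: "'a \<Rightarrow> real^'n::{finite,linorder}^'n::{finite,linorder}"
  assumes M: "prob_space M" and A: "gaussian_wigner M A"
    and ind: "prob_space.indep_var M borel A borel Z"
    and Z: "distr M borel Z = distr M borel A"
    and h[measurable]: "h \<in> borel_measurable (borel \<Otimes>\<^sub>M borel)"
  shows "(\<integral>\<^sup>+\<omega>. h (A \<omega>, Z \<omega>) \<partial>M) =
     (\<integral>\<^sup>+x. h (wigner_of True x, wigner_of False x) \<partial>Pi\<^sub>M (UNIV \<times> {(u, v). u \<le> v}) (\<lambda>_. std_gaussian))"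
proof -
  interpret prob_space M by fact
  interpret product_sigma_finite "\<lambda>_. std_gaussian"
    by (simp add: product_sigma_finite_def prob_space_normal_density prob_space_imp_sigma_finite)
  define K :: "bool \<Rightarrow> (bool \<times> 'n \<times> 'n) set" where "K c = {c} \<times> {(u, v). u \<le> v}" for c
  have KU: "UNIV \<times> {(u, v). u \<le> v} = K True \<union> K False" by (auto simp: K_def)
  have [measurable]: "A \<in> borel_measurable M" "Z \<in> borel_measurable M"
    using ind by (auto simp: indep_var_distribution_eq)
  have w: "wigner_of c \<in> borel_measurable (Pi\<^sub>M (K c) (\<lambda>_. std_gaussian))" for c
    by (rule measurable_wigner_of) (simp add: K_def)
  have wU: "wigner_of c \<in> borel_measurable (Pi\<^sub>M (K True \<union> K False) (\<lambda>_. std_gaussian))" for c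
    by (rule measurable_wigner_of) (cases c; auto simp: K_def)
  have sf: "sigma_finite_measure (distr M borel A)" by (simp add: prob_space_distr prob_space_imp_sigma_finite)
  have "(\<integral>\<^sup>+\<omega>. h (A \<omega>, Z \<omega>) \<partial>M) = (\<integral>\<^sup>+p. h p \<partial>distr M (borel \<Otimes>\<^sub>M borel) (\<lambda>\<omega>. (A \<omega>, Z \<omega>)))"
    by (subst nn_integral_distr) auto
  also have "\<dots> = (\<integral>\<^sup>+p. h p \<partial>(distr M borel A \<Otimes>\<^sub>M distr M borel A))"
    using ind Z by (simp add: indep_var_distribution_eq)
  also have "\<dots> = (\<integral>\<^sup>+a. \<integral>\<^sup>+z. h (a, z) \<partial>distr M borel A \<partial>distr M borel A)"
    using sigma_finite_measure.nn_integral_fst[OF sf, of h "distr M borel A"] by simp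
  also have "\<dots> = (\<integral>\<^sup>+a. \<integral>\<^sup>+y. h (a, wigner_of False y) \<partial>Pi\<^sub>M (K False) (\<lambda>_. std_gaussian) \<partial>distr M borel A)"
    by (subst distr_gaussian_wigner[OF M A, of False], subst nn_integral_distr) (auto intro: w[unfolded K_def] simp: K_def)
  also have "\<dots> = (\<integral>\<^sup>+x. \<integral>\<^sup>+y. h (wigner_of True x, wigner_of False y)
      \<partial>Pi\<^sub>M (K False) (\<lambda>_. std_gaussian) \<partial>Pi\<^sub>M (K True) (\<lambda>_. std_gaussian))"
  proof -
    \<comment> \<open>The inner integral gets a name because the change of variables in the outer
      one needs its measurability.\<close>
    define H where "H a = (\<integral>\<^sup>+y. h (a, wigner_of False y) \<partial>Pi\<^sub>M (K False) (\<lambda>_. std_gaussian))" for a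
    interpret F: sigma_finite_measure "Pi\<^sub>M (K False) (\<lambda>_. std_gaussian)"
      by (intro prob_space_imp_sigma_finite prob_space_PiM prob_space_normal_density) simp
    note w[measurable]
    have "H \<in> borel_measurable borel"
      unfolding H_def by measurable
    then have "(\<integral>\<^sup>+a. H a \<partial>distr M borel A) = (\<integral>\<^sup>+x. H (wigner_of True x) \<partial>Pi\<^sub>M (K True) (\<lambda>_. std_gaussian))"
      using w[of True] by (subst distr_gaussian_wigner[OF M A, of True], subst nn_integral_distr) (auto simp: K_def)
    then show ?thesis by (simp add: H_def)
  qed
  \<comment> \<open>Each matrix reads only the coordinates with its own tag, so merging the other
    block in changes nothing.\<close>
  also have "\<dots> = (\<integral>\<^sup>+x. \<integral>\<^sup>+y. h (wigner_of True (merge (K True) (K False) (x, y)), wigner_of False (merge (K True) (K False) (x, y)))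
      \<partial>Pi\<^sub>M (K False) (\<lambda>_. std_gaussian) \<partial>Pi\<^sub>M (K True) (\<lambda>_. std_gaussian))"
  proof -
    have "wigner_of True (merge (K True) (K False) (x, y)) = wigner_of True x"
      "wigner_of False (merge (K True) (K False) (x, y)) = wigner_of False y" for x y :: "bool \<times> 'n \<times> 'n \<Rightarrow> real"
      by (auto simp: wigner_of_def vec_eq_iff merge_def K_def wigner_key_def min_le_max)
    then show ?thesis by simp
  qed
  also have "\<dots> = (\<integral>\<^sup>+x. h (wigner_of True x, wigner_of False x) \<partial>Pi\<^sub>M (K True \<union> K False) (\<lambda>_. std_gaussian))"
    by (rule product_nn_integral_fold[symmetric]) (use wU in \<open>auto simp: K_def intro!: measurable_compose[OF _ h]\<close>)
  finally show ?thesis by (simp add: KU)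
qed

section \<open>Chernoff bound for one row comparison\<close>

lemma wigner_key_eq_iff:
  "wigner_key c u v = wigner_key c' u' v' \<longleftrightarrow> c = c' \<and> (u = u' \<and> v = v' \<or> u = v' \<and> v = u')"
  by (auto simp: wigner_key_def min_def max_def split: if_splits)

lemma wigner_of_sym: "wigner_of c x $ u $ v = wigner_of c x $ v $ u"
  by (simp add: wigner_of_def wigner_key_def entry_scale_def min.commute max.commute)

lemma sum_UNIV_triple:
  fixes F :: "'a::finite \<times> 'b::finite \<times> 'c::finite \<Rightarrow> 'd::comm_monoid_add"
  shows "(\<Sum>l\<in>UNIV. F l) = (\<Sum>c\<in>UNIV. \<Sum>q\<in>UNIV. \<Sum>k\<in>UNIV. F (c, q, k))"
  by (simp only: UNIV_Times_UNIV[symmetric] sum.cartesian_product')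

text \<open>Injectivity leaves at most one nonzero term. It is used to count how often a coordinate
  occurs among the monomials.\<close>

lemma sum_of_bool_inj_le:
  fixes a :: "'k \<Rightarrow> real"
  assumes "finite K" "inj_on g K" "\<And>k. k \<in> K \<Longrightarrow> a k \<le> b" "0 \<le> b"
  shows "(\<Sum>k\<in>K. a k * of_bool (g k = u)) \<le> b"
proof (cases "\<exists>k\<in>K. g k = u")
  case True
  then obtain k0 where k0: "k0 \<in> K" "g k0 = u" by auto
  have "(\<Sum>k\<in>K. a k * of_bool (g k = u)) = (\<Sum>k\<in>K. if k = k0 then a k else 0)"
    using assms(2) k0 by (intro sum.cong) (auto simp: inj_on_def)
  then show ?thesis using assms k0 by simp
next
  case False
  then have "(\<Sum>k\<in>K. a k * of_bool (g k = u)) = 0" by (intro sum.neutral) auto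
  then show ?thesis using assms by simp
qed

lemma sum_entry_scale_squared:
  "(\<Sum>v\<in>UNIV. (entry_scale u v)\<^sup>2) = real CARD('n) + 1" for u :: "'n::finite"
proof -
  have "(\<Sum>v\<in>UNIV. (entry_scale u v)\<^sup>2) = (\<Sum>v\<in>UNIV. 1 + (if v = u then 1 else 0 :: real))"
    by (intro sum.cong) (auto simp: entry_scale_def)
  then show ?thesis by (simp add: sum.distrib)
qed

text \<open>This is \<open>C\<^sub>i\<^sub>i - C\<^sub>i\<^sub>j\<close> for \<open>C = AXB\<close>, where row \<open>k\<close> of \<open>X\<close> has its one in column \<open>p k\<close>.\<close>

definition dominance_gap ::
  "real \<Rightarrow> real \<Rightarrow> ('n \<Rightarrow> 'n) \<Rightarrow> 'n \<Rightarrow> 'n \<Rightarrow> (real^'n^'n) \<times> (real^'n^'n) \<Rightarrow> real" where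
  "dominance_gap s \<sigma> p i j = (\<lambda>(A, Z). \<Sum>k\<in>UNIV. A $ i $ k *
     (s * (A $ p k $ i - A $ p k $ j) + \<sigma> * (Z $ p k $ i - Z $ p k $ j)))"

text \<open>The gap, scaled by \<open>- \<tau> * n\<close>, is expanded into monomials with
  occurrence bound \<open>R = 8 * S * \<tau>\<close>, total weight at most
  \<open>2 * S * \<tau> * (n + 1)\<close> and squares summing to at most
  \<open>- (\<tau> * s * (m - 1))\<close>. The parameter \<open>\<tau>\<close> is such that
  \<open>R = s * m / (20 * S * n)\<close>, which is at most \<open>1/20\<close> because
  \<open>s \<le> S\<close> and \<open>m \<le> n\<close>.\<close>

lemma dominance_gap_exp_bound:
  fixes p :: "'n::{finite,linorder} \<Rightarrow> 'n" and s \<sigma> :: real and i j :: 'n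
  defines "m \<equiv> real (card {k. p k = k})" and "n \<equiv> real CARD('n)" and "S \<equiv> s + \<sigma>"
  defines "\<tau> \<equiv> s * m / (160 * S\<^sup>2 * n)"
  assumes p: "bij p" and ij: "i \<noteq> j" and m: "10 \<le> m"
    and s: "0 \<le> s" and \<sigma>: "0 \<le> \<sigma>" and S: "1 \<le> S"
  shows "(\<integral>\<^sup>+x. ennreal (exp (- (\<tau> * n * dominance_gap s \<sigma> p i j (wigner_of True x, wigner_of False x))))
       \<partial>Pi\<^sub>M (UNIV \<times> {(u, v). u \<le> v}) (\<lambda>_. std_gaussian))
     \<le> ennreal (exp (- (s\<^sup>2 * m\<^sup>2 / (384 * S\<^sup>2 * n))))"
proof -
  \<comment> \<open>A monomial has an index \<open>(c, q, k)\<close>: \<open>c\<close> tells whether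
    the second factor comes from \<open>A\<close> (weight \<open>s\<close>) or from \<open>Z\<close>
    (weight \<open>\<sigma>\<close>), \<open>q\<close> whether it belongs to the diagonal entry
    (sign plus) or to the off-diagonal one (sign minus), and \<open>k\<close> is the summation index
    of the matrix product. The first factor always comes from row \<open>i\<close> of
    \<open>A\<close>.\<close>
  define row where "row q = (if q then i else j)" for q
  define w where "w c = (if c then s else \<sigma>)" for c
  define sg where "sg q = (if q then 1 else -1 :: real)" for q
  define e where "e = (\<lambda>(c::bool, q::bool, k). wigner_key True i k)"
  define f where "f = (\<lambda>(c, q, k). wigner_key c (row q) (p k))"
  define a where "a = (\<lambda>(c, q, k). - \<tau> * w c * sg q * (entry_scale i k * entry_scale (row q) (p k)))"
  define R where "R = 8 * S * \<tau>"
  define E where "E = s\<^sup>2 * m\<^sup>2 / (S\<^sup>2 * n)"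
  have n: "0 < n" by (simp add: n_def)
  have mn: "m \<le> n" unfolding m_def n_def by (simp add: card_mono)
  have \<tau>: "0 \<le> \<tau>" using s m n by (simp add: \<tau>_def)
  have w: "0 \<le> w c" for c using s \<sigma> by (simp add: w_def)
  have \<tau>w: "0 \<le> \<tau> * w c" for c using \<tau> w by simp
  have sc0: "0 \<le> entry_scale u v" for u v :: 'n by (simp add: entry_scale_def)
  have sc2: "entry_scale u v * entry_scale u' v' \<le> 2" for u v u' v' :: 'n
    by (auto simp: entry_scale_def sqrt2_less_2 less_imp_le)
  have R: "0 \<le> R" "R \<le> 1/20"
  proof -
    show "0 \<le> R" using S \<tau> by (simp add: R_def)
    have "s * m \<le> S * n" using s \<sigma> mn m by (intro mult_mono) (auto simp: S_def)
    then have "s * m / (160 * (S * n)) \<le> 1/160"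
      using S n by (simp add: divide_le_eq)
    also have "s * m / (160 * (S * n)) = S * \<tau>" using S n by (simp add: \<tau>_def power2_eq_square)
    finally show "R \<le> 1/20" by (simp add: R_def)
  qed
  have abs_a: "\<bar>a (c, q, k)\<bar> = \<tau> * w c * (entry_scale i k * entry_scale (row q) (p k))" for c q k
    using \<tau> w[of c] sc0 by (simp add: a_def abs_mult sg_def)
  have gap: "- (\<tau> * n * dominance_gap s \<sigma> p i j (wigner_of True x, wigner_of False x))
      = (\<Sum>l\<in>UNIV. a l * x (e l) * x (f l))" for x
  proof -
    have entry: "n * (wigner_of True x $ i $ k * wigner_of c x $ p k $ row q)
        = entry_scale i k * entry_scale (row q) (p k) * x (wigner_key True i k) * x (wigner_key c (row q) (p k))" for c q k
      using n by (simp add: wigner_of_sym[of c x "p k" "row q"]) (simp add: wigner_of_def n_def)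
    have "n * dominance_gap s \<sigma> p i j (wigner_of True x, wigner_of False x)
      = (\<Sum>k\<in>UNIV. \<Sum>c\<in>UNIV. \<Sum>q\<in>UNIV. w c * sg q * (n * (wigner_of True x $ i $ k * wigner_of c x $ p k $ row q)))"
      unfolding dominance_gap_def sum_distrib_left prod.case
      by (intro sum.cong refl) (simp add: UNIV_bool w_def sg_def row_def algebra_simps)
    then have "- (\<tau> * n * dominance_gap s \<sigma> p i j (wigner_of True x, wigner_of False x))
        = - \<tau> * (\<Sum>k\<in>UNIV. \<Sum>c\<in>UNIV. \<Sum>q\<in>UNIV. w c * sg q * (n * (wigner_of True x $ i $ k * wigner_of c x $ p k $ row q)))"
      by simp
    also have "\<dots> = (\<Sum>k\<in>UNIV. \<Sum>c\<in>UNIV. \<Sum>q\<in>UNIV. a (c, q, k) * x (e (c, q, k)) * x (f (c, q, k)))"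
      unfolding sum_distrib_left entry by (intro sum.cong refl) (simp add: a_def e_def f_def mult_ac)
    also have "\<dots> = (\<Sum>l\<in>UNIV. a l * x (e l) * x (f l))"
      unfolding sum_UNIV_triple by (subst (3) sum.swap, subst (2) sum.swap) simp
    finally show ?thesis .
  qed
  \<comment> \<open>For fixed \<open>c\<close> and \<open>q\<close> both coordinate maps are
    injective in \<open>k\<close>, so a coordinate occurs at most once as a first and once as a
    second factor, each time with weight at most \<open>2 * \<tau> * w c\<close>. Summing over
    \<open>c\<close> and \<open>q\<close> gives \<open>8 * S * \<tau>\<close>.\<close>
  have rows: "(\<Sum>l\<in>UNIV. \<bar>a l\<bar> * (of_bool (e l = u) + of_bool (f l = u))) \<le> R" for u
  proof -
    have inj_e: "inj (\<lambda>k. wigner_key True i k)" and inj_f: "inj (\<lambda>k. wigner_key c (row q) (p k))" for c q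
      using bij_is_inj[OF p] by (auto simp: inj_def wigner_key_eq_iff)
    have le: "\<bar>a (c, q, k)\<bar> \<le> 2 * \<tau> * w c" for c q k
      unfolding abs_a using mult_left_mono[OF sc2 \<tau>w[of c]] by (simp add: mult_ac)
    have "(\<Sum>k\<in>UNIV. \<bar>a (c, q, k)\<bar> * (of_bool (e (c, q, k) = u) + of_bool (f (c, q, k) = u))) \<le> 4 * \<tau> * w c" for c q
    proof -
      have "(\<Sum>k\<in>UNIV. \<bar>a (c, q, k)\<bar> * of_bool (wigner_key True i k = u)) \<le> 2 * \<tau> * w c"
        using \<tau>w[of c] by (intro sum_of_bool_inj_le inj_e le) auto
      moreover have "(\<Sum>k\<in>UNIV. \<bar>a (c, q, k)\<bar> * of_bool (wigner_key c (row q) (p k) = u)) \<le> 2 * \<tau> * w c"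
        using \<tau>w[of c] by (intro sum_of_bool_inj_le inj_f le) auto
      ultimately show ?thesis by (simp add: e_def f_def distrib_left sum.distrib)
    qed
    then have "(\<Sum>l\<in>UNIV. \<bar>a l\<bar> * (of_bool (e l = u) + of_bool (f l = u)))
      \<le> (\<Sum>c\<in>UNIV. \<Sum>q\<in>(UNIV::bool set). 4 * \<tau> * w c)"
      unfolding sum_UNIV_triple by (intro sum_mono)
    also have "\<dots> = R" by (simp add: UNIV_bool w_def R_def S_def algebra_simps)
    finally show ?thesis .
  qed
  \<comment> \<open>Bounding the product of two scales by the mean of their squares gives
    \<open>n + 1\<close> per choice of \<open>c\<close> and \<open>q\<close>, where the crude bound
    by 2 would give \<open>2 * n\<close>.\<close>
  have total: "(\<Sum>l\<in>UNIV. \<bar>a l\<bar>) \<le> 2 * S * \<tau> * (n + 1)"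
  proof -
    have "(\<Sum>k\<in>UNIV. \<bar>a (c, q, k)\<bar>) \<le> \<tau> * w c * (n + 1)" for c q
    proof -
      have "(\<Sum>k\<in>UNIV. \<bar>a (c, q, k)\<bar>) \<le> (\<Sum>k\<in>UNIV. \<tau> * w c * (((entry_scale i k)\<^sup>2 + (entry_scale (row q) (p k))\<^sup>2) / 2))"
        unfolding abs_a
      proof (intro sum_mono mult_left_mono \<tau>w)
        show "entry_scale i k * entry_scale (row q) (p k) \<le> ((entry_scale i k)\<^sup>2 + (entry_scale (row q) (p k))\<^sup>2) / 2" for k
          using sum_squares_bound[of "entry_scale i k" "entry_scale (row q) (p k)"] by simp
      qed
      also have "\<dots> = \<tau> * w c * (((\<Sum>k\<in>UNIV. (entry_scale i k)\<^sup>2) + (\<Sum>k\<in>UNIV. (entry_scale (row q) (p k))\<^sup>2)) / 2)"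
        by (simp add: sum_distrib_left[symmetric] sum_divide_distrib[symmetric] sum.distrib)
      also have "(\<Sum>k\<in>UNIV. (entry_scale (row q) (p k))\<^sup>2) = (\<Sum>k\<in>UNIV. (entry_scale (row q) k)\<^sup>2)"
        by (rule sum.reindex_bij_betw[OF p])
      finally show ?thesis by (simp add: sum_entry_scale_squared n_def algebra_simps)
    qed
    then have "(\<Sum>l\<in>UNIV. \<bar>a l\<bar>) \<le> (\<Sum>c\<in>UNIV. \<Sum>q\<in>(UNIV::bool set). \<tau> * w c * (n + 1))"
      unfolding sum_UNIV_triple by (intro sum_mono)
    also have "\<dots> = 2 * S * \<tau> * (n + 1)" by (simp add: UNIV_bool w_def S_def algebra_simps)
    finally show ?thesis .
  qed
  \<comment> \<open>Besides the squares at fixed points of \<open>p\<close>, the only possible square is that of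
    \<open>A\<^sub>i\<^sub>j\<close>, when \<open>p j = i\<close>; it has the wrong sign and costs one fixed point.\<close>
  have diag: "(\<Sum>l\<in>{l\<in>UNIV. e l = f l}. a l) \<le> - (\<tau> * s * (m - 1))"
  proof -
    have off: "e (False, q, k) \<noteq> f (False, q, k)" for q k
      by (simp add: e_def f_def wigner_key_def)
    have "(\<Sum>l\<in>{l\<in>UNIV. e l = f l}. a l) = (\<Sum>l\<in>UNIV. if e l = f l then a l else 0)"
      by (simp add: sum.inter_filter[symmetric])
    also have "\<dots> = (\<Sum>k\<in>UNIV. (if e (True, True, k) = f (True, True, k) then a (True, True, k) else 0)
        + (if e (True, False, k) = f (True, False, k) then a (True, False, k) else 0))"
      unfolding sum_UNIV_triple UNIV_bool by (simp add: off sum.distrib)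
    also have "\<dots> \<le> (\<Sum>k\<in>UNIV. (if p k = k then - \<tau> * s else 0) + (if k = j then \<tau> * s else 0))"
    proof (intro sum_mono add_mono)
      fix k
      have "e (True, True, k) = f (True, True, k) \<longleftrightarrow> p k = k"
        by (auto simp: e_def f_def row_def wigner_key_eq_iff)
      moreover have "\<tau> * s \<le> \<tau> * s * (entry_scale i k * entry_scale i k)"
        using \<tau> s by (simp add: entry_scale_def)
      ultimately show "(if e (True, True, k) = f (True, True, k) then a (True, True, k) else 0)
          \<le> (if p k = k then - \<tau> * s else 0)"
        by (simp add: a_def w_def sg_def row_def)
      have "e (True, False, k) = f (True, False, k) \<longleftrightarrow> k = j \<and> p k = i"
        using ij by (auto simp: e_def f_def row_def wigner_key_eq_iff)
      then show "(if e (True, False, k) = f (True, False, k) then a (True, False, k) else 0)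
          \<le> (if k = j then \<tau> * s else 0)"
        using ij \<tau> s by (auto simp: a_def w_def sg_def row_def entry_scale_def)
    qed
    also have "\<dots> = - (\<tau> * s * (m - 1))"
      by (simp add: m_def sum.distrib sum.If_cases algebra_simps)
    finally show ?thesis .
  qed
  \<comment> \<open>In units of \<open>E / 1600\<close> the four terms are -10, at most 1, exactly 3
    and at most 0.3; the second and fourth use \<open>m \<ge> 10\<close> and
    \<open>n \<ge> 10\<close>. The sum is at most -5.7, below \<open>- 1600 / 384\<close>.\<close>
  have "- (\<tau> * s * (m - 1)) + 3 * R * (2 * S * \<tau> * (n + 1)) \<le> - (E / 384)"
  proof -
    have E1: "\<tau> * s * m = E / 160" by (simp add: \<tau>_def E_def power2_eq_square mult_ac)
    have E2: "S\<^sup>2 * \<tau>\<^sup>2 * n = E / 25600"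
      using n S by (simp add: \<tau>_def E_def power2_eq_square field_simps mult_ac)
    have "\<tau> * s * 10 \<le> \<tau> * s * m" using \<tau> s m by (intro mult_left_mono) auto
    moreover have "S\<^sup>2 * \<tau>\<^sup>2 * 10 \<le> S\<^sup>2 * \<tau>\<^sup>2 * n" using m mn by (intro mult_left_mono) auto
    moreover have "- (\<tau> * s * (m - 1)) + 3 * R * (2 * S * \<tau> * (n + 1))
        = - (\<tau> * s * m) + \<tau> * s + 48 * (S\<^sup>2 * \<tau>\<^sup>2 * n) + 48 * (S\<^sup>2 * \<tau>\<^sup>2)"
      by (simp add: R_def power2_eq_square algebra_simps)
    moreover have "0 \<le> E" using n by (simp add: E_def)
    ultimately show ?thesis using E1 E2 by linarith
  qed
  moreover have "3 * R * (\<Sum>l\<in>UNIV. \<bar>a l\<bar>) \<le> 3 * R * (2 * S * \<tau> * (n + 1))"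
    using total R by (intro mult_left_mono) auto
  ultimately have expo: "(\<Sum>l\<in>{l\<in>UNIV. e l = f l}. a l) + 3 * R * (\<Sum>l\<in>UNIV. \<bar>a l\<bar>) \<le> - (E / 384)"
    using diag by linarith
  have "(\<integral>\<^sup>+x. ennreal (exp (\<Sum>l\<in>UNIV. a l * x (e l) * x (f l)))
       \<partial>Pi\<^sub>M (UNIV \<times> {(u, v). u \<le> v}) (\<lambda>_. std_gaussian))
     \<le> ennreal (exp ((\<Sum>l\<in>{l\<in>UNIV. e l = f l}. a l) + 3 * R * (\<Sum>l\<in>UNIV. \<bar>a l\<bar>)))"
  proof (rule gaussian_monomials_exp_bound)
    show "range e \<subseteq> UNIV \<times> {(u, v). u \<le> v}" "range f \<subseteq> UNIV \<times> {(u, v). u \<le> v}"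
      by (auto simp: e_def f_def wigner_key_def min_le_max)
  qed (use R rows in auto)
  also have "\<dots> \<le> ennreal (exp (- (E / 384)))"
    using expo by (intro ennreal_leI) simp
  also have "E / 384 = s\<^sup>2 * m\<^sup>2 / (384 * S\<^sup>2 * n)" by (simp add: E_def)
  finally show ?thesis by (simp only: gap)
qed

section \<open>Permutation matrices, the noise constant and the tail bound for one pair of
  entries\<close>

lemma matrix_mult_permutation_mult:
  fixes A B :: "real^'n^'n" and p :: "'n \<Rightarrow> 'n"
  shows "(A ** (\<chi> i j. if j = p i then 1 else 0) ** B) $ i $ l = (\<Sum>k\<in>UNIV. A $ i $ k * B $ p k $ l)"
proof -
  have "(A ** (\<chi> i j. if j = p i then 1 else 0) ** B) $ i $ l
      = (\<Sum>k\<in>UNIV. A $ i $ k * (\<Sum>h\<in>UNIV. (if h = p k then 1 else 0) * B $ h $ l))"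
    by (subst matrix_mul_assoc[symmetric]) (simp add: matrix_matrix_mult_def)
  also have "\<dots> = (\<Sum>k\<in>UNIV. A $ i $ k * (\<Sum>h\<in>UNIV. if h = p k then B $ h $ l else 0))"
    by (intro sum.cong refl arg_cong2[of _ _ _ _ "(*)"]) auto
  finally show ?thesis by simp
qed

text \<open>A row with \<open>p i \<noteq> i\<close> of the difference has exactly two nonzero
  entries, 1 and -1; the other rows vanish.\<close>

lemma frobenius_norm_permutation_minus_id:
  fixes p :: "'n::finite \<Rightarrow> 'n"
  shows "(frobenius_norm ((\<chi> i j. if j = p i then 1 else 0) - mat 1))\<^sup>2
    = 2 * (real CARD('n) - real (card {k. p k = k}))"
proof -
  have row: "(\<Sum>j\<in>UNIV. (((\<chi> i j. if j = p i then 1 else 0) - mat 1 :: real^'n^'n) $ i $ j)\<^sup>2)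
      = 2 - (if p i = i then 2 else 0)" for i
  proof (cases "p i = i")
    case True
    then show ?thesis by (auto simp: mat_def intro!: sum.neutral)
  next
    case False
    then have "(\<Sum>j\<in>UNIV. (((\<chi> i j. if j = p i then 1 else 0) - mat 1 :: real^'n^'n) $ i $ j)\<^sup>2)
      = (\<Sum>j\<in>UNIV. (if j = p i then 1 else 0) + (if j = i then 1 else 0))"
      by (intro sum.cong refl) (auto simp: mat_def)
    then show ?thesis using False by (simp add: sum.distrib)
  qed
  have "(frobenius_norm ((\<chi> i j. if j = p i then 1 else 0) - mat 1 :: real^'n^'n))\<^sup>2
     = (\<Sum>i\<in>UNIV. 2 - (if p i = i then 2 else 0))"
    unfolding frobenius_norm_def row by (simp add: sum_nonneg)
  also have "\<dots> = 2 * (real CARD('n) - real (card {k. p k = k}))"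
    by (simp add: sum_subtractf sum.If_cases)
  finally show ?thesis .
qed

text \<open>With \<open>s = sqrt (1 - \<sigma>\<^sup>2)\<close> the squares of \<open>s\<close> and
  \<open>\<sigma>\<close> add up to one, so the denominator \<open>1 + 2 * \<sigma> * s\<close> is
  the square of \<open>s + \<sigma>\<close>.\<close>

lemma c_noise_eq:
  assumes "0 \<le> \<sigma>" "\<sigma> < 1"
  shows "c_noise \<sigma> = (sqrt (1 - \<sigma>\<^sup>2))\<^sup>2 / (384 * (sqrt (1 - \<sigma>\<^sup>2) + \<sigma>)\<^sup>2)"
    and "1 \<le> sqrt (1 - \<sigma>\<^sup>2) + \<sigma>" and "0 < c_noise \<sigma>"
proof -
  have \<sigma>: "\<sigma>\<^sup>2 < 1" using assms by (simp add: power_less_one_iff abs_square_less_1)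
  have s: "(sqrt (1 - \<sigma>\<^sup>2))\<^sup>2 = 1 - \<sigma>\<^sup>2" using \<sigma> by simp
  have S: "(sqrt (1 - \<sigma>\<^sup>2) + \<sigma>)\<^sup>2 = 1 + 2 * \<sigma> * sqrt (1 - \<sigma>\<^sup>2)"
    unfolding power2_sum s by simp
  then show "c_noise \<sigma> = (sqrt (1 - \<sigma>\<^sup>2))\<^sup>2 / (384 * (sqrt (1 - \<sigma>\<^sup>2) + \<sigma>)\<^sup>2)"
    by (simp add: s c_noise_def)
  have "1\<^sup>2 \<le> (sqrt (1 - \<sigma>\<^sup>2) + \<sigma>)\<^sup>2" unfolding S using assms \<sigma> by simp
  then show "1 \<le> sqrt (1 - \<sigma>\<^sup>2) + \<sigma>" using assms \<sigma> by (intro power2_le_imp_le[of 1]) auto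
  have "0 < 1 + 2 * \<sigma> * sqrt (1 - \<sigma>\<^sup>2)" using assms \<sigma> by (intro add_pos_nonneg) auto
  then show "0 < c_noise \<sigma>" using \<sigma> by (simp add: c_noise_def)
qed

lemma borel_measurable_matrix_nth [measurable]:
  "(\<lambda>A :: real^'n^'m. A $ i $ j) \<in> borel_measurable borel"
  by (intro borel_measurable_continuous_onI continuous_intros)

lemma correlated_gaussian_wigner_measurable:
  assumes "prob_space M" and "correlated_gaussian_wigner M \<sigma> A B"
  shows "(\<lambda>\<omega>. A \<omega> $ i $ j) \<in> borel_measurable M" "(\<lambda>\<omega>. B \<omega> $ i $ j) \<in> borel_measurable M"
proof -
  interpret prob_space M by fact
  obtain Z where ind: "indep_var borel A borel Z"
    and B: "\<And>\<omega>. \<omega> \<in> space M \<Longrightarrow> B \<omega> $ i $ j = sqrt (1 - \<sigma>\<^sup>2) * A \<omega> $ i $ j + \<sigma> * Z \<omega> $ i $ j"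
    using assms(2) unfolding correlated_gaussian_wigner_def by blast
  have [measurable]: "A \<in> borel_measurable M" "Z \<in> borel_measurable M"
    using ind by (auto simp: indep_var_distribution_eq)
  show "(\<lambda>\<omega>. A \<omega> $ i $ j) \<in> borel_measurable M" by measurable
  have "(\<lambda>\<omega>. sqrt (1 - \<sigma>\<^sup>2) * A \<omega> $ i $ j + \<sigma> * Z \<omega> $ i $ j) \<in> borel_measurable M" by measurable
  then show "(\<lambda>\<omega>. B \<omega> $ i $ j) \<in> borel_measurable M"
    by (subst measurable_cong[OF B])
qed

text \<open>Exponential Markov inequality: the event says that the gap is at most 0, and there
  \<open>exp (- (\<tau> * n * gap))\<close> is at least 1. Its expectation is evaluated in Gaussian
  coordinates and bounded by \<open>dominance_gap_exp_bound\<close>, whence the choice of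
  \<open>\<tau>\<close>.\<close>

lemma prob_diag_le_off_diag:
  fixes A B :: "'a \<Rightarrow> real^'n::{finite,linorder}^'n::{finite,linorder}" and p :: "'n \<Rightarrow> 'n"
  defines "m \<equiv> real (card {k. p k = k})" and "P \<equiv> (\<chi> i j. if j = p i then 1 else 0)"
  assumes M: "prob_space M" and corr: "correlated_gaussian_wigner M \<sigma> A B"
    and \<sigma>: "0 \<le> \<sigma>" "\<sigma> < 1" and p: "bij p" and ij: "i \<noteq> j" and m: "10 \<le> m"
  shows "\<P>(\<omega> in M. (A \<omega> ** P ** B \<omega>) $ i $ i \<le> (A \<omega> ** P ** B \<omega>) $ i $ j)
     \<le> exp (- (c_noise \<sigma> * (m / real CARD('n))\<^sup>2 * real CARD('n)))"
proof -
  interpret prob_space M by fact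
  define s where "s = sqrt (1 - \<sigma>\<^sup>2)"
  define S where "S = s + \<sigma>"
  define n where "n = real CARD('n)"
  define \<tau> where "\<tau> = s * m / (160 * S\<^sup>2 * n)"
  define h where "h q = ennreal (exp (- (\<tau> * n * dominance_gap s \<sigma> p i j q)))" for q
  have n: "0 < n" by (simp add: n_def)
  have s: "0 \<le> s" using \<sigma> by (simp add: s_def power_le_one)
  have S: "1 \<le> S" using c_noise_eq(2)[OF \<sigma>] by (simp add: S_def s_def)
  have \<tau>: "0 \<le> \<tau>" using s m n by (simp add: \<tau>_def)
  obtain Z where A: "gaussian_wigner M A" and ind: "indep_var borel A borel Z"
    and Z: "distr M borel Z = distr M borel A"
    and B: "\<And>\<omega> i j. \<omega> \<in> space M \<Longrightarrow> B \<omega> $ i $ j = s * A \<omega> $ i $ j + \<sigma> * Z \<omega> $ i $ j"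
    using corr unfolding correlated_gaussian_wigner_def s_def by blast
  have [measurable]: "A \<in> borel_measurable M" "Z \<in> borel_measurable M"
    using ind by (auto simp: indep_var_distribution_eq)
  have gap: "(A \<omega> ** P ** B \<omega>) $ i $ i - (A \<omega> ** P ** B \<omega>) $ i $ j = dominance_gap s \<sigma> p i j (A \<omega>, Z \<omega>)"
    if "\<omega> \<in> space M" for \<omega>
    unfolding P_def matrix_mult_permutation_mult dominance_gap_def B[OF that] prod.case sum_subtractf[symmetric]
    by (intro sum.cong refl) (simp add: algebra_simps)
  have gap_meas [measurable]: "dominance_gap s \<sigma> p i j \<in> borel_measurable (borel \<Otimes>\<^sub>M borel)"
    unfolding dominance_gap_def by measurable
  have h_meas [measurable]: "h \<in> borel_measurable (borel \<Otimes>\<^sub>M borel)"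
    unfolding h_def by measurable
  have event: "\<P>(\<omega> in M. (A \<omega> ** P ** B \<omega>) $ i $ i \<le> (A \<omega> ** P ** B \<omega>) $ i $ j)
      = \<P>(\<omega> in M. dominance_gap s \<sigma> p i j (A \<omega>, Z \<omega>) \<le> 0)"
    using gap by (intro arg_cong[of _ _ prob] Collect_cong) force
  have "ennreal \<P>(\<omega> in M. dominance_gap s \<sigma> p i j (A \<omega>, Z \<omega>) \<le> 0)
      = (\<integral>\<^sup>+\<omega>. indicator {\<omega> \<in> space M. dominance_gap s \<sigma> p i j (A \<omega>, Z \<omega>) \<le> 0} \<omega> \<partial>M)"
    by (simp add: emeasure_eq_measure)
  also have "\<dots> \<le> (\<integral>\<^sup>+\<omega>. h (A \<omega>, Z \<omega>) \<partial>M)"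
  proof (intro nn_integral_mono)
    fix \<omega>
    have "1 \<le> exp (- (\<tau> * n * y))" if "y \<le> 0" for y
      using \<tau> n that by (simp add: mult_nonneg_nonpos)
    then show "indicator {\<omega> \<in> space M. dominance_gap s \<sigma> p i j (A \<omega>, Z \<omega>) \<le> 0} \<omega> \<le> h (A \<omega>, Z \<omega>)"
      unfolding h_def by (auto simp: indicator_def simp flip: ennreal_1 intro!: ennreal_leI)
  qed
  also have "\<dots> = (\<integral>\<^sup>+x. h (wigner_of True x, wigner_of False x) \<partial>Pi\<^sub>M (UNIV \<times> {(u, v). u \<le> v}) (\<lambda>_. std_gaussian))"
    by (rule nn_integral_indep_wigner[OF M A ind Z h_meas])
  also have "\<dots> \<le> ennreal (exp (- (s\<^sup>2 * m\<^sup>2 / (384 * S\<^sup>2 * n))))"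
    unfolding h_def \<tau>_def S_def n_def m_def
    using s \<sigma> S m by (intro dominance_gap_exp_bound p ij) (auto simp: S_def m_def)
  also have "s\<^sup>2 * m\<^sup>2 / (384 * S\<^sup>2 * n) = c_noise \<sigma> * (m / n)\<^sup>2 * n"
    unfolding c_noise_eq(1)[OF \<sigma>] using n by (simp add: s_def S_def power2_eq_square)
  finally show ?thesis by (simp add: event n_def)
qed

section \<open>Greedy matching of diagonally dominant matrices\<close>

text \<open>By induction the rows and columns already removed coincide, so when row
  \<open>r k\<close> is selected its diagonal entry is still available; dominance then forces
  \<open>c k = r k\<close>. The selected rows are pairwise distinct, so all diagonal positions are
  reached.\<close>

lemma gmwm_diagonally_dominant:
  fixes C P :: "real^'n^'n"
  assumes C: "diagonally_dominant C" and P: "gmwm C P"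
  shows "P = mat 1"
proof -
  obtain r c :: "nat \<Rightarrow> 'n" where
    rc: "\<And>k. k < CARD('n) \<Longrightarrow> r k \<notin> r ` {..<k} \<and> c k \<notin> c ` {..<k} \<and>
        (\<forall>i j. i \<notin> r ` {..<k} \<and> j \<notin> c ` {..<k} \<longrightarrow> C $ i $ j \<le> C $ r k $ c k)"
    and P: "P = (\<chi> i j. if \<exists>k<CARD('n). i = r k \<and> j = c k then 1 else 0)"
    using P unfolding gmwm_def by blast
  have eq: "r k = c k" if "k < CARD('n)" for k
    using that
  proof (induction k rule: less_induct)
    case (less k)
    have "r ` {..<k} = c ` {..<k}" using less by (intro image_cong) auto
    then have "C $ r k $ r k \<le> C $ r k $ c k" using rc[OF less.prems] by auto
    then show ?case using C by (force simp: diagonally_dominant_def)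
  qed
  have "inj_on r {..<CARD('n)}"
  proof (rule linorder_inj_onI)
    fix x y assume "x < y" "x \<in> {..<CARD('n)}" "y \<in> {..<CARD('n)}"
    then show "r x \<noteq> r y" using rc[of y] by (metis imageI lessThan_iff)
  qed auto
  then have "card (r ` {..<CARD('n)}) = CARD('n)" by (simp add: card_image)
  then have "r ` {..<CARD('n)} = UNIV" by (intro card_subset_eq) auto
  then have "\<exists>k<CARD('n). i = r k" for i by (metis UNIV_I imageE lessThan_iff)
  then have "(\<exists>k<CARD('n). i = r k \<and> j = c k) \<longleftrightarrow> i = j" for i j using eq by metis
  then show ?thesis unfolding P by (simp add: mat_def)
qed

section \<open>Union bound and recovery of the identity in one iteration\<close>

lemma ppmgm_1_iff: "ppmgm A B X 1 Y \<longleftrightarrow> gmwm (A ** X ** B) Y"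
proof
  assume "gmwm (A ** X ** B) Y"
  then show "ppmgm A B X 1 Y"
    unfolding ppmgm_def by (intro exI[of _ "\<lambda>k. if k = 0 then X else Y"]) auto
qed (auto simp: ppmgm_def)

text \<open>Failure of dominance is a union over the ordered pairs \<open>i \<noteq> j\<close>, of
  which there are at most \<open>n\<^sup>2\<close>. Its measurability is recorded as well, for
  monotonicity of the measure in the next lemma.\<close>

lemma prob_not_diagonally_dominant:
  fixes A B :: "'a \<Rightarrow> real^'n::{finite,linorder}^'n::{finite,linorder}"
    and X :: "real^'n::{finite,linorder}^'n::{finite,linorder}"
  defines "n \<equiv> real CARD('n)"
  assumes M: "prob_space M" and corr: "correlated_gaussian_wigner M \<sigma> A B"
    and \<sigma>: "0 \<le> \<sigma>" "\<sigma> < 1" and X: "permutation_matrix X"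
    and \<theta>: "0 \<le> \<theta>" "\<theta> \<le> sqrt (2 * (1 - 10 / n))" "frobenius_norm (X - mat 1) \<le> \<theta> * sqrt n"
  shows "{\<omega> \<in> space M. \<not> diagonally_dominant (A \<omega> ** X ** B \<omega>)} \<in> sets M"
    and "\<P>(\<omega> in M. \<not> diagonally_dominant (A \<omega> ** X ** B \<omega>))
      \<le> n\<^sup>2 * exp (- (c_noise \<sigma> * (1 - \<theta>\<^sup>2 / 2)\<^sup>2 * n))"
proof -
  interpret prob_space M by fact
  obtain p where p: "bij p" and Xp: "X = (\<chi> i j. if j = p i then 1 else 0)"
    using X by (auto simp: permutation_matrix_def)
  define m where "m = real (card {k. p k = k})"
  define b where "b = exp (- (c_noise \<sigma> * (1 - \<theta>\<^sup>2 / 2)\<^sup>2 * n))"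
  define bad where "bad = (\<lambda>(i, j). {\<omega> \<in> space M. (A \<omega> ** X ** B \<omega>) $ i $ i \<le> (A \<omega> ** X ** B \<omega>) $ i $ j})"
  define J :: "('n \<times> 'n) set" where "J = {(i, j). i \<noteq> j}"
  have n: "0 < n" by (simp add: n_def)
  have "(frobenius_norm (X - mat 1))\<^sup>2 \<le> (\<theta> * sqrt n)\<^sup>2"
    using \<theta> by (intro power_mono) (auto simp: frobenius_norm_def sum_nonneg)
  then have m1: "(1 - \<theta>\<^sup>2 / 2) * n \<le> m"
    using n by (simp add: Xp frobenius_norm_permutation_minus_id m_def n_def[symmetric] power_mult_distrib algebra_simps)
  \<comment> \<open>The real \<open>sqrt\<close> is negative at negative arguments, so a nonnegative
    \<open>\<theta>\<close> below it forces the radicand to be nonnegative.\<close>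
  have "0 \<le> 2 * (1 - 10 / n)"
    using \<theta>(1,2) real_sqrt_ge_0_iff by (meson order_trans)
  then have "\<theta>\<^sup>2 \<le> 2 * (1 - 10 / n)"
    using power_mono[OF \<theta>(2,1), of 2] by simp
  then have "10 / n \<le> 1 - \<theta>\<^sup>2 / 2" by simp
  then have m2: "10 \<le> (1 - \<theta>\<^sup>2 / 2) * n" using n by (simp add: divide_le_eq)
  \<comment> \<open>The sign is needed to square the inequality between
    \<open>1 - \<theta>\<^sup>2 / 2\<close> and \<open>m / n\<close>.\<close>
  have \<theta>2: "0 \<le> 1 - \<theta>\<^sup>2 / 2" using m2 n zero_le_mult_iff[of "1 - \<theta>\<^sup>2 / 2" n] by linarith
  note [measurable] = correlated_gaussian_wigner_measurable[OF M corr]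
  have bad_sets: "bad q \<in> sets M" for q
    unfolding bad_def Xp matrix_mult_permutation_mult case_prod_unfold by measurable
  have bad_prob: "prob (bad q) \<le> b" if "q \<in> J" for q
  proof -
    obtain i j where q: "q = (i, j)" "i \<noteq> j" using \<open>q \<in> J\<close> by (auto simp: J_def)
    have "prob (bad q) \<le> exp (- (c_noise \<sigma> * (m / n)\<^sup>2 * n))"
      using prob_diag_le_off_diag[OF M corr \<sigma> p q(2)] m1 m2 by (simp add: q bad_def Xp m_def n_def)
    also have "\<dots> \<le> b"
    proof -
      have "1 - \<theta>\<^sup>2 / 2 \<le> m / n" using m1 n by (simp add: le_divide_eq)
      then have "(1 - \<theta>\<^sup>2 / 2)\<^sup>2 \<le> (m / n)\<^sup>2" using \<theta>2 by (intro power_mono)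
      then show ?thesis
        using c_noise_eq(3)[OF \<sigma>] n by (simp add: b_def)
    qed
    finally show ?thesis .
  qed
  have eq: "{\<omega> \<in> space M. \<not> diagonally_dominant (A \<omega> ** X ** B \<omega>)} = (\<Union>q\<in>J. bad q)"
    by (fastforce simp: diagonally_dominant_def bad_def J_def not_less)
  show "{\<omega> \<in> space M. \<not> diagonally_dominant (A \<omega> ** X ** B \<omega>)} \<in> sets M"
    unfolding eq using bad_sets by auto
  have "prob (\<Union>q\<in>J. bad q) \<le> (\<Sum>q\<in>J. prob (bad q))"
    using bad_sets by (intro finite_measure_subadditive_finite) auto
  also have "\<dots> \<le> real (card J) * b"
    by (intro sum_bounded_above bad_prob)
  also have "\<dots> \<le> n\<^sup>2 * b"
  proof (intro mult_right_mono)
    have "card J \<le> card (UNIV :: ('n \<times> 'n) set)" by (intro card_mono) auto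
    then show "real (card J) \<le> n\<^sup>2"
      by (simp add: n_def card_cartesian_product power2_eq_square flip: UNIV_Times_UNIV of_nat_mult)
  qed (simp add: b_def)
  finally show "\<P>(\<omega> in M. \<not> diagonally_dominant (A \<omega> ** X ** B \<omega>))
      \<le> n\<^sup>2 * exp (- (c_noise \<sigma> * (1 - \<theta>\<^sup>2 / 2)\<^sup>2 * n))"
    by (simp add: eq b_def)
qed

text \<open>However ties are broken, the output can differ from the identity only where dominance
  fails; measurability of \<open>Y\<close> makes this an event whose complement can be
  taken.\<close>

lemma prob_gmwm_eq_id:
  fixes A B :: "'a \<Rightarrow> real^'n::{finite,linorder}^'n::{finite,linorder}"
    and X :: "real^'n::{finite,linorder}^'n::{finite,linorder}"
  defines "n \<equiv> real CARD('n)"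
  assumes M: "prob_space M" and corr: "correlated_gaussian_wigner M \<sigma> A B"
    and \<sigma>: "0 \<le> \<sigma>" "\<sigma> < 1" and X: "permutation_matrix X"
    and \<theta>: "0 \<le> \<theta>" "\<theta> \<le> sqrt (2 * (1 - 10 / n))" "frobenius_norm (X - mat 1) \<le> \<theta> * sqrt n"
    and Y: "Y \<in> borel_measurable M" "\<And>\<omega>. \<omega> \<in> space M \<Longrightarrow> gmwm (A \<omega> ** X ** B \<omega>) (Y \<omega>)"
  shows "\<P>(\<omega> in M. Y \<omega> = mat 1) \<ge> 1 - n\<^sup>2 * exp (- (c_noise \<sigma> * (1 - \<theta>\<^sup>2 / 2)\<^sup>2 * n))"
proof -
  interpret prob_space M by fact
  note [measurable] = Y(1)
  have N: "{\<omega> \<in> space M. \<not> diagonally_dominant (A \<omega> ** X ** B \<omega>)} \<in> events"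
    using prob_not_diagonally_dominant(1)[OF M corr \<sigma> X \<theta>(1)] \<theta> by (simp add: n_def)
  have "prob {\<omega> \<in> space M. \<not> Y \<omega> = mat 1} \<le> prob {\<omega> \<in> space M. \<not> diagonally_dominant (A \<omega> ** X ** B \<omega>)}"
    using gmwm_diagonally_dominant Y(2) by (intro finite_measure_mono N) auto
  also have "\<dots> \<le> n\<^sup>2 * exp (- (c_noise \<sigma> * (1 - \<theta>\<^sup>2 / 2)\<^sup>2 * n))"
    using prob_not_diagonally_dominant(2)[OF M corr \<sigma> X \<theta>(1)] \<theta> by (simp add: n_def)
  finally show ?thesis
    by (subst (asm) prob_neg) auto
qed

theorem theorem1:
  fixes M :: "'a measure"
    and A B :: "'a \<Rightarrow> real^'n::{finite,linorder}^'n::{finite,linorder}"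
    and X :: "real^'n::{finite,linorder}^'n::{finite,linorder}"
    and \<sigma> \<theta> :: real
    and n :: nat
  assumes "prob_space M"
    and "n = CARD('n)" and "n \<ge> 10"
    and "0 \<le> \<sigma>" and "\<sigma> < 1"
    and "correlated_gaussian_wigner M \<sigma> A B"
    and "permutation_matrix X"
    and "frobenius_norm (X - mat 1) \<le> \<theta> * sqrt (real n)"
    and "0 \<le> \<theta>" and "\<theta> \<le> sqrt (2 * (1 - 10 / real n))"
  shows "\<P>(\<omega> in M. \<not> diagonally_dominant (A \<omega> ** X ** B \<omega>))
           \<le> 5 * (real n)\<^sup>2 * exp (- (c_noise \<sigma> * (1 - \<theta>\<^sup>2 / 2)\<^sup>2 * real n)) \<and>
         (\<forall>Y \<in> borel_measurable M.
           (\<forall>\<omega>\<in>space M. ppmgm (A \<omega>) (B \<omega>) X 1 (Y \<omega>)) \<longrightarrow>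
             \<P>(\<omega> in M. Y \<omega> = mat 1)
               \<ge> 1 - 5 * (real n)\<^sup>2 * exp (- (c_noise \<sigma> * (1 - \<theta>\<^sup>2 / 2)\<^sup>2 * real n)) \<and>
             ((frobenius_norm (X - mat 1))\<^sup>2
                 \<le> 2 * (real n - sqrt (1 / c_noise \<sigma> * real n * ln (5 * real n ^ 3)))
               \<longrightarrow> \<P>(\<omega> in M. Y \<omega> = mat 1) \<ge> 1 - 1 / real n))"
proof (intro conjI ballI impI)
  \<comment> \<open>The union bound gives \<open>b\<close>; the factor 5 of the claim is
    slack.\<close>
  define b where "b = (real n)\<^sup>2 * exp (- (c_noise \<sigma> * (1 - \<theta>\<^sup>2 / 2)\<^sup>2 * real n))"
  have b: "b \<le> 5 * (real n)\<^sup>2 * exp (- (c_noise \<sigma> * (1 - \<theta>\<^sup>2 / 2)\<^sup>2 * real n))"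
    by (simp add: b_def)
  have "\<P>(\<omega> in M. \<not> diagonally_dominant (A \<omega> ** X ** B \<omega>)) \<le> b"
    unfolding b_def using assms by (intro order_trans[OF prob_not_diagonally_dominant(2)]) auto
  then show "\<P>(\<omega> in M. \<not> diagonally_dominant (A \<omega> ** X ** B \<omega>))
           \<le> 5 * (real n)\<^sup>2 * exp (- (c_noise \<sigma> * (1 - \<theta>\<^sup>2 / 2)\<^sup>2 * real n))"
    using b by linarith
  fix Y assume Y: "Y \<in> borel_measurable M" and "\<forall>\<omega>\<in>space M. ppmgm (A \<omega>) (B \<omega>) X 1 (Y \<omega>)"
  then have gm: "\<And>\<omega>. \<omega> \<in> space M \<Longrightarrow> gmwm (A \<omega> ** X ** B \<omega>) (Y \<omega>)"
    by (simp only: ppmgm_1_iff)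
  \<comment> \<open>Stated for every admissible radius \<open>t\<close>: it is used for
    \<open>\<theta>\<close> itself and then for the exact normalised distance of \<open>X\<close>
    from the identity.\<close>
  have main: "\<P>(\<omega> in M. Y \<omega> = mat 1) \<ge> 1 - (real n)\<^sup>2 * exp (- (c_noise \<sigma> * (1 - t\<^sup>2 / 2)\<^sup>2 * real n))"
    if "0 \<le> t" "t \<le> sqrt (2 * (1 - 10 / real n))" "frobenius_norm (X - mat 1) \<le> t * sqrt (real n)" for t
    using prob_gmwm_eq_id[OF assms(1,6,4,5,7) _ _ _ Y gm] that assms(2) by blast
  show "\<P>(\<omega> in M. Y \<omega> = mat 1)
               \<ge> 1 - 5 * (real n)\<^sup>2 * exp (- (c_noise \<sigma> * (1 - \<theta>\<^sup>2 / 2)\<^sup>2 * real n))"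
    using main[OF assms(9,10,8)] b unfolding b_def by linarith
  define F where "F = frobenius_norm (X - mat 1)"
  \<comment> \<open>The smallest radius that \<open>X\<close> satisfies; being at most
    \<open>\<theta>\<close>, it inherits the upper bound on \<open>\<theta>\<close>.\<close>
  define t where "t = F / sqrt (real n)"
  define c where "c = c_noise \<sigma>"
  define l where "l = ln (5 * real n ^ 3)"
  assume "(frobenius_norm (X - mat 1))\<^sup>2
                 \<le> 2 * (real n - sqrt (1 / c_noise \<sigma> * real n * ln (5 * real n ^ 3)))"
  then have F2: "sqrt (real n * l / c) \<le> real n - F\<^sup>2 / 2" by (simp add: F_def l_def c_def field_simps)
  have n: "real n > 0" using assms by simp
  have c: "c > 0" using c_noise_eq(3) assms by (simp add: c_def)
  have "1 \<le> real n ^ 3" using assms by (intro one_le_power) simp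
  then have l: "0 \<le> l" by (simp add: l_def)
  have t2: "t\<^sup>2 = F\<^sup>2 / real n" using n by (simp add: t_def power_divide)
  have t: "0 \<le> t" "t \<le> \<theta>" "F \<le> t * sqrt (real n)"
    using assms(8) n by (auto simp: t_def F_def frobenius_norm_def sum_nonneg divide_le_eq)
  \<comment> \<open>Squaring the hypothesis on the norm and cancelling one factor \<open>n\<close>
    shows that the exponent at \<open>t\<close> is at least \<open>l\<close>.\<close>
  have "real n * l / c = (sqrt (real n * l / c))\<^sup>2" using n l c by simp
  also have "\<dots> \<le> (real n - F\<^sup>2 / 2)\<^sup>2"
    using F2 n l c by (intro power_mono) auto
  also have "real n - F\<^sup>2 / 2 = (1 - t\<^sup>2 / 2) * real n"
    using n by (simp add: t2 field_simps)
  finally have "real n * (l / c) \<le> real n * ((1 - t\<^sup>2 / 2)\<^sup>2 * real n)"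
    by (simp add: power_mult_distrib power2_eq_square[of "real n"] mult_ac)
  then have "l / c \<le> (1 - t\<^sup>2 / 2)\<^sup>2 * real n"
    using n by (simp only: mult_le_cancel_left_pos)
  then have "l \<le> c * (1 - t\<^sup>2 / 2)\<^sup>2 * real n"
    using c by (simp add: pos_divide_le_eq mult_ac)
  then have "exp (- (c * (1 - t\<^sup>2 / 2)\<^sup>2 * real n)) \<le> exp (- l)" by simp
  \<comment> \<open>Multiplied by \<open>n\<^sup>2\<close> this leaves
    \<open>1 / (5 * n)\<close>.\<close>
  also have "exp (- l) = 1 / (5 * real n ^ 3)"
    using n by (simp add: l_def exp_minus inverse_eq_divide)
  finally have "(real n)\<^sup>2 * exp (- (c * (1 - t\<^sup>2 / 2)\<^sup>2 * real n)) \<le> (real n)\<^sup>2 * (1 / (5 * real n ^ 3))"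
    by (intro mult_left_mono) auto
  also have "\<dots> \<le> 1 / real n" using n by (simp add: power2_eq_square power3_eq_cube field_simps)
  finally show "\<P>(\<omega> in M. Y \<omega> = mat 1) \<ge> 1 - 1 / real n"
    using main[of t] t assms(10) by (simp add: F_def c_def)
qed

end
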